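(* For $n\ge 1$ let $E_n$ denote the number of edges incident to the root vertex in a uniformly random rooted map with $n$ edges (no restriction on genus). Then, as $n\to\infty$, $$\frac{E_n}{n}\ \overset{d}{\longrightarrow}\ \mathrm{Beta}\bigl(1,\tfrac12\bigr),$$ the distribution with density function $\tfrac12(1-t)^{-1/2}$ for $t\in[0,1)$.
   Context: A map is a connected multigraph (loops and multiple edges allowed) endowed with a cyclic ordering of the half-edges incident to each vertex. Around each vertex, each pair of consecutive half-edges in the cyclic order forms a corner (a vertex with only one half-edge has one corner; a vertex of degree $d\ge1$ has $d$ corners; the one-vertex map with no edge has exactly one corner). A rooted map is a map with a distinguished corner; the vertex at this corner is the root vertex. Rooted maps are considered up to isomorphisms preserving the graph structure, the root corner and the cyclic orderings. "Random rooted map with $n$ edges" means that all rooted maps with $n$ edges are equally likely. In counting the edges incident to the root vertex, each loop at the root vertex is counted once. $\overset{d}{\longrightarrow}$ is convergence in distribution. *)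

theory Defs
  imports "HOL-Probability.Probability"
begin

section \<open>Maps\<close>

text \<open>
  A multigraph is given by its vertices and half-edges: \<open>base\<close> sends a half-edge to the vertex
  it is incident to, and \<open>mate\<close> is the fixed-point-free involution pairing the two halves of each
  edge (for a loop, both halves have the same base). The rotation \<open>rot\<close> sends a half-edge to the
  next one in the cyclic order around its base vertex. The values of the three functions outside
  \<open>halves\<close> carry no meaning.
\<close>

record ('v, 'h) premap =
  verts :: "'v set"
  halves :: "'h set"
  base :: "'h \<Rightarrow> 'v"
  mate :: "'h \<Rightarrow> 'h"
  rot :: "'h \<Rightarrow> 'h"

definition halves_at :: "('v, 'h) premap \<Rightarrow> 'v \<Rightarrow> 'h set" where
  "halves_at M v = {h \<in> halves M. base M h = v}"

definition edges :: "('v, 'h) premap \<Rightarrow> 'h set set" where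
  "edges M = {{h, mate M h} |h. h \<in> halves M}"

definition adjacency :: "('v, 'h) premap \<Rightarrow> ('v \<times> 'v) set" where
  "adjacency M = {(base M h, base M (mate M h)) |h. h \<in> halves M}"

definition is_multigraph :: "('v, 'h) premap \<Rightarrow> bool" where
  "is_multigraph M \<longleftrightarrow>
     finite (verts M) \<and> finite (halves M) \<and>
     (\<forall>h\<in>halves M. base M h \<in> verts M \<and>
        mate M h \<in> halves M \<and> mate M h \<noteq> h \<and> mate M (mate M h) = h)"

definition is_connected :: "('v, 'h) premap \<Rightarrow> bool" where
  "is_connected M \<longleftrightarrow> verts M \<noteq> {} \<and> (\<forall>u\<in>verts M. \<forall>v\<in>verts M. (u, v) \<in> (adjacency M)\<^sup>*)"

definition cyclic_on :: "('h \<Rightarrow> 'h) \<Rightarrow> 'h set \<Rightarrow> bool" where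
  "cyclic_on s H \<longleftrightarrow> bij_betw s H H \<and> (\<forall>h\<in>H. \<forall>h'\<in>H. \<exists>k. (s ^^ k) h = h')"

definition is_map :: "('v, 'h) premap \<Rightarrow> bool" where
  "is_map M \<longleftrightarrow> is_multigraph M \<and> is_connected M \<and>
     (\<forall>v\<in>verts M. cyclic_on (rot M) (halves_at M v))"

section \<open>Rooted maps up to isomorphism\<close>

text \<open>
  The corner \<open>Between h h'\<close> lies between the consecutive half-edges \<open>h\<close> and \<open>h' = rot M h\<close>
  (with \<open>h = h'\<close> at a vertex of degree one); \<open>Lone v\<close> is the only corner at a vertex \<open>v\<close> without
  half-edges, which occurs only in the map without edges.
\<close>

datatype ('v, 'h) corner = Lone 'v | Between 'h 'h

definition corners :: "('v, 'h) premap \<Rightarrow> ('v, 'h) corner set" where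
  "corners M = {Between h (rot M h) |h. h \<in> halves M} \<union>
               {Lone v |v. v \<in> verts M \<and> halves_at M v = {}}"

fun corner_vertex :: "('v, 'h) premap \<Rightarrow> ('v, 'h) corner \<Rightarrow> 'v" where
  "corner_vertex M (Lone v) = v"
| "corner_vertex M (Between h h') = base M h"

type_synonym ('v, 'h) rooted_premap = "('v, 'h) premap \<times> ('v, 'h) corner"

definition is_rooted_map :: "('v, 'h) rooted_premap \<Rightarrow> bool" where
  "is_rooted_map R \<longleftrightarrow> is_map (fst R) \<and> snd R \<in> corners (fst R)"

definition is_rooted_iso ::
    "('v \<Rightarrow> 'w) \<Rightarrow> ('h \<Rightarrow> 'k) \<Rightarrow> ('v, 'h) rooted_premap \<Rightarrow> ('w, 'k) rooted_premap \<Rightarrow> bool" where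
  "is_rooted_iso f g R S \<longleftrightarrow> (let M = fst R; N = fst S in
     bij_betw f (verts M) (verts N) \<and> bij_betw g (halves M) (halves N) \<and>
     (\<forall>h\<in>halves M. base N (g h) = f (base M h) \<and> mate N (g h) = g (mate M h) \<and>
        rot N (g h) = g (rot M h)) \<and>
     map_corner f g (snd R) = snd S)"

text \<open>
  Vertices and half-edges are labelled by natural numbers; every finite map has such a labelling,
  so this does not restrict the isomorphism classes.
\<close>

definition labelled_rooted_maps :: "nat \<Rightarrow> (nat, nat) rooted_premap set" where
  "labelled_rooted_maps n = {R. is_rooted_map R \<and> card (edges (fst R)) = n}"

definition rooted_iso_rel :: "nat \<Rightarrow> ((nat, nat) rooted_premap \<times> (nat, nat) rooted_premap) set" where
  "rooted_iso_rel n = {(R, S). R \<in> labelled_rooted_maps n \<and> S \<in> labelled_rooted_maps n \<and>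
     (\<exists>f g. is_rooted_iso f g R S)}"

definition rooted_maps :: "nat \<Rightarrow> (nat, nat) rooted_premap set set" where
  "rooted_maps n = labelled_rooted_maps n // rooted_iso_rel n"

text \<open>Edges being sets of half-edges, a loop at the root vertex counts once.\<close>

definition root_edges :: "('v, 'h) rooted_premap \<Rightarrow> 'h set set" where
  "root_edges R = {e \<in> edges (fst R). \<exists>h\<in>e. base (fst R) h = corner_vertex (fst R) (snd R)}"

text \<open>
  The same count for an isomorphism class; \<open>card \<circ> root_edges\<close> is constant on each class
  (\<open>card_root_edges_iso\<close> below).
\<close>

definition root_edge_count :: "('v, 'h) rooted_premap set \<Rightarrow> nat" where
  "root_edge_count C = the_elem ((\<lambda>R. card (root_edges R)) ` C)"

lemma map_half_edge_closed:
  assumes "is_map M" "h \<in> halves M"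
  shows "base M h \<in> verts M" "mate M h \<in> halves M" "rot M h \<in> halves M"
proof -
  show b: "base M h \<in> verts M" and "mate M h \<in> halves M"
    using assms unfolding is_map_def is_multigraph_def by auto
  have "cyclic_on (rot M) (halves_at M (base M h))"
    using assms b unfolding is_map_def by blast
  then have "rot M ` halves_at M (base M h) = halves_at M (base M h)"
    unfolding cyclic_on_def bij_betw_def by blast
  moreover have "h \<in> halves_at M (base M h)" using assms by (simp add: halves_at_def)
  ultimately have "rot M h \<in> halves_at M (base M h)" by blast
  then show "rot M h \<in> halves M" by (simp add: halves_at_def)
qed

lemma corner_cases:
  assumes "is_rooted_map R"
  obtains (lone) v where "snd R = Lone v" "v \<in> verts (fst R)"
  | (between) h where "snd R = Between h (rot (fst R) h)" "h \<in> halves (fst R)"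
  using assms unfolding is_rooted_map_def corners_def by auto

lemma is_rooted_iso_sym:
  assumes R: "is_rooted_map R" and iso: "is_rooted_iso f g R S"
  shows "is_rooted_iso (inv_into (verts (fst R)) f) (inv_into (halves (fst R)) g) S R"
proof -
  let ?M = "fst R" and ?N = "fst S"
  let ?f = "inv_into (verts ?M) f" and ?g = "inv_into (halves ?M) g"
  have M: "is_map ?M" using R by (simp add: is_rooted_map_def)
  have f: "bij_betw f (verts ?M) (verts ?N)" and g: "bij_betw g (halves ?M) (halves ?N)"
    and c: "\<And>h. h \<in> halves ?M \<Longrightarrow> base ?N (g h) = f (base ?M h) \<and> mate ?N (g h) = g (mate ?M h) \<and>
        rot ?N (g h) = g (rot ?M h)"
    and r: "map_corner f g (snd R) = snd S"
    using iso unfolding is_rooted_iso_def Let_def by auto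
  have fi: "?f (f v) = v" if "v \<in> verts ?M" for v using f that by (meson bij_betw_inv_into_left)
  have gi: "?g (g h) = h" if "h \<in> halves ?M" for h using g that by (meson bij_betw_inv_into_left)
  have "base ?M (?g k) = ?f (base ?N k) \<and> mate ?M (?g k) = ?g (mate ?N k) \<and>
        rot ?M (?g k) = ?g (rot ?N k)" if "k \<in> halves ?N" for k
  proof -
    have "k \<in> g ` halves ?M" using g that by (simp add: bij_betw_def)
    then obtain h where h: "h \<in> halves ?M" "k = g h" by blast
    show ?thesis using c[OF h(1)] h fi gi map_half_edge_closed[OF M h(1)] by simp
  qed
  moreover have "map_corner ?f ?g (snd S) = snd R"
    using R
  proof (cases rule: corner_cases)
    case lone then show ?thesis using r[symmetric] fi by simp
  next
    case between
    then show ?thesis using r[symmetric] gi map_half_edge_closed[OF M between(2)] by simp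
  qed
  ultimately show ?thesis
    unfolding is_rooted_iso_def Let_def
    using bij_betw_inv_into[OF f] bij_betw_inv_into[OF g] by (intro conjI ballI) simp_all
qed

lemma is_rooted_iso_trans:
  assumes "is_rooted_iso f g R S" "is_rooted_iso f' g' S T"
  shows "is_rooted_iso (f' \<circ> f) (g' \<circ> g) R T"
proof -
  have g: "\<And>h. h \<in> halves (fst R) \<Longrightarrow> g h \<in> halves (fst S)"
    using assms(1) unfolding is_rooted_iso_def Let_def bij_betw_def by blast
  have m: "map_corner (f' \<circ> f) (g' \<circ> g) (snd R) = map_corner f' g' (map_corner f g (snd R))"
    by (simp add: corner.map_comp)
  show ?thesis
    using assms g unfolding is_rooted_iso_def Let_def m by (auto intro: bij_betw_trans)
qed

lemma equiv_rooted_iso_rel: "equiv (labelled_rooted_maps n) (rooted_iso_rel n)"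
proof (rule equivI)
  show "rooted_iso_rel n \<subseteq> labelled_rooted_maps n \<times> labelled_rooted_maps n"
    by (auto simp: rooted_iso_rel_def)
  have "is_rooted_iso id id R R" for R :: "(nat, nat) rooted_premap"
    by (simp add: is_rooted_iso_def corner.map_id)
  then show "refl_on (labelled_rooted_maps n) (rooted_iso_rel n)"
    by (auto simp: refl_on_def rooted_iso_rel_def)
  show "sym (rooted_iso_rel n)"
    using is_rooted_iso_sym
    by (fastforce simp: sym_def rooted_iso_rel_def labelled_rooted_maps_def)
  show "trans (rooted_iso_rel n)"
    using is_rooted_iso_trans by (fastforce simp: trans_def rooted_iso_rel_def)
qed

lemma card_root_edges_iso:
  assumes R: "is_rooted_map R" and iso: "is_rooted_iso f g R S"
  shows "card (root_edges S) = card (root_edges R)"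
proof -
  let ?M = "fst R" and ?N = "fst S"
  have M: "is_map ?M" using R by (simp add: is_rooted_map_def)
  have f: "inj_on f (verts ?M)" and g: "inj_on g (halves ?M)"
    and gN: "halves ?N = g ` halves ?M"
    and c: "\<And>h. h \<in> halves ?M \<Longrightarrow> base ?N (g h) = f (base ?M h)"
           "\<And>h. h \<in> halves ?M \<Longrightarrow> mate ?N (g h) = g (mate ?M h)"
    and r: "map_corner f g (snd R) = snd S"
    using iso unfolding is_rooted_iso_def Let_def bij_betw_def by auto
  have cl: "base ?M h \<in> verts ?M" "mate ?M h \<in> halves ?M" if "h \<in> halves ?M" for h
    using map_half_edge_closed[OF M that] by auto
  define v where "v = corner_vertex ?M (snd R)"
  have v: "v \<in> verts ?M \<and> corner_vertex ?N (snd S) = f v"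
    using R by (cases rule: corner_cases) (use r[symmetric] c cl in \<open>auto simp: v_def\<close>)
  have 1: "root_edges T = (\<lambda>h. {h, mate (fst T) h}) ` {h \<in> halves (fst T).
      base (fst T) h = corner_vertex (fst T) (snd T) \<or>
      base (fst T) (mate (fst T) h) = corner_vertex (fst T) (snd T)}"
    for T :: "('x, 'y) rooted_premap"
    unfolding root_edges_def edges_def by auto
  have *: "(base ?N (g h) = f v \<or> base ?N (mate ?N (g h)) = f v) \<longleftrightarrow>
        (base ?M h = v \<or> base ?M (mate ?M h) = v)" if "h \<in> halves ?M" for h
    using c(1)[OF that] c(1)[OF cl(2)[OF that]] c(2)[OF that] cl(1)[OF that]
      cl(1)[OF cl(2)[OF that]] v inj_on_eq_iff[OF f] by simp
  have "root_edges S = (\<lambda>h. {g h, mate ?N (g h)}) ` {h \<in> halves ?M.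
      base ?N (g h) = f v \<or> base ?N (mate ?N (g h)) = f v}"
    unfolding 1 gN using v by auto
  also have "\<dots> = (\<lambda>h. g ` {h, mate ?M h}) ` {h \<in> halves ?M. base ?M h = v \<or> base ?M (mate ?M h) = v}"
  proof (rule image_cong)
    show "{h \<in> halves ?M. base ?N (g h) = f v \<or> base ?N (mate ?N (g h)) = f v} =
        {h \<in> halves ?M. base ?M h = v \<or> base ?M (mate ?M h) = v}"
      using * by blast
  qed (simp add: c(2))
  also have "\<dots> = (`) g ` root_edges R"
    unfolding 1 v_def[symmetric] image_image ..
  finally have "root_edges S = (`) g ` root_edges R" .
  moreover have "inj_on ((`) g) (root_edges R)"
    by (rule inj_on_subset[OF inj_on_image_Pow[OF g]]) (use cl in \<open>auto simp: 1\<close>)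
  ultimately show ?thesis by (simp add: card_image)
qed

lemma root_edge_count_class:
  assumes "C \<in> rooted_maps n" "R \<in> C"
  shows "root_edge_count C = card (root_edges R)"
proof -
  have "card (root_edges S) = card (root_edges R)" if "S \<in> C" for S
  proof -
    have "(R, S) \<in> rooted_iso_rel n"
      using assms that quotient_eq_iff[OF equiv_rooted_iso_rel] unfolding rooted_maps_def by blast
    then obtain f g where "is_rooted_map R" "is_rooted_iso f g R S"
      unfolding rooted_iso_rel_def labelled_rooted_maps_def by blast
    then show ?thesis by (rule card_root_edges_iso)
  qed
  then have "(\<lambda>S. card (root_edges S)) ` C = (\<lambda>_. card (root_edges R)) ` C"
    by (rule image_cong[OF refl])
  then show ?thesis by (simp only: root_edge_count_def image_constant[OF assms(2)] the_elem_eq)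
qed

section \<open>Beta distribution\<close>

definition beta_density :: "real \<Rightarrow> real \<Rightarrow> real \<Rightarrow> real" where
  "beta_density a b t =
     (if 0 < t \<and> t < 1 then t powr (a - 1) * (1 - t) powr (b - 1) / Beta a b else 0)"

definition beta_distribution :: "real \<Rightarrow> real \<Rightarrow> real measure" where
  "beta_distribution a b = density lborel (\<lambda>t. ennreal (beta_density a b t))"

lemma beta_distribution_1_half:
  "beta_distribution 1 (1/2) =
     density lborel (\<lambda>t. ennreal (if 0 \<le> t \<and> t < 1 then 1/2 * (1 - t) powr (-1/2) else 0))"
proof -
  have "(1/2 :: real) \<notin> \<int>\<^sub>\<le>\<^sub>0"
    using nonpos_Ints_nonpos[of "1/2 :: real"] by linarith
  from Gamma_plus1[OF this] have G: "Gamma (3/2 :: real) = sqrt pi / 2"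
    by (simp add: Gamma_one_half_real)
  have B: "Beta 1 (1/2 :: real) = 2"
    by (simp add: Beta_def G Gamma_one_half_real)
  have eq: "beta_density 1 (1/2) t = (if 0 \<le> t \<and> t < 1 then 1/2 * (1 - t) powr (-1/2) else 0)"
    if "t \<noteq> 0" for t
    using that by (simp add: beta_density_def B)
  have "AE t in lborel. t \<noteq> (0::real)" by (rule AE_lborel_singleton)
  then have "AE t in lborel. ennreal (beta_density 1 (1/2) t) =
      ennreal (if 0 \<le> t \<and> t < 1 then 1/2 * (1 - t) powr (-1/2) else 0)"
    by eventually_elim (rule arg_cong[OF eq])
  then show ?thesis
    unfolding beta_distribution_def
    by (intro density_cong) (simp_all add: beta_density_def)
qed

end

theory Submission
  imports Defs
begin

text \<open>
  A rooted map with $n$ edges is a pair of permutations of the $2n$ half-edges, the rotation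
  \<open>\<sigma>\<close> and a fixed-point-free involution \<open>\<alpha>\<close> generating a transitive group, up to relabelling with
  the root half-edge kept at \<open>0\<close>. Transitivity makes this action of relabellings free, so a uniform
  rooted map is the class of a uniform transitive pair. A fraction of at most $4/n$ of all pairs is
  intransitive, so it suffices to study a uniform \<open>\<sigma>\<close> for fixed \<open>\<alpha>\<close>.

  For a uniform permutation, the cycle of \<open>0\<close> avoids a given set of $k$ other points with
  probability $1/(k+1)$. Hence the number $U$ of edges that miss the root vertex satisfies
  $E\binom{U}{m} = \binom{n-1}{m}/(2m+1)$, so the moments of $U/n = 1 - E_n/n$ tend to $1/(2m+1)$,
  which are the moments of $1 - X$ for $X$ of law Beta$(1,1/2)$. By Weierstrass approximation on
  $[0,1]$ convergence of moments implies weak convergence.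
\<close>

section \<open>Cycles of a uniform permutation\<close>

text \<open>Missed edges are counted rather than incident ones because avoidance has a closed
  formula: an edge misses the root vertex exactly when both its half-edges avoid the cycle of the
  root half-edge, so m missed edges amount to 2m avoided points. The edge of the root half-edge is
  never missed, whence n - 1, and a loop at the root vertex needs no special treatment. The obstacle
  is transitivity. It makes all classes equally large, with (2n - 1)! pairs each, but restricting
  the rotations to transitive ones would spoil the insertion of points into cycles on which the
  avoidance probability rests. So for each involution the sum runs over all rotations, is compared
  with the number of all pairs, and is then corrected for the intransitive ones. The moment of order
  0 of the same estimate says that almost all pairs are transitive; this permits passing from the
  number of all pairs to that of transitive pairs as the normalisation.\<close>

definition cycle_of :: "('a \<Rightarrow> 'a) \<Rightarrow> 'a \<Rightarrow> 'a set" where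
  "cycle_of f x = range (\<lambda>k. (f ^^ k) x)"

lemma self_in_cycle_of: "x \<in> cycle_of f x"
  unfolding cycle_of_def by (rule range_eqI[of _ _ 0]) simp

lemma cycle_of_closed: "f ` cycle_of f x \<subseteq> cycle_of f x"
proof -
  have "f ((f ^^ k) x) \<in> cycle_of f x" for k
    unfolding cycle_of_def by (rule range_eqI[of _ _ "Suc k"]) simp
  then show ?thesis by (auto simp: cycle_of_def)
qed

lemma cycle_of_least:
  assumes "x \<in> B" "f ` B \<subseteq> B"
  shows "cycle_of f x \<subseteq> B"
proof -
  have "(f ^^ k) x \<in> B" for k using assms by (induction k) auto
  then show ?thesis by (auto simp: cycle_of_def)
qed

text \<open>An injection that maps a finite set into itself maps it onto itself, so such a set is
  also closed under preimages. This lets \<open>cycle_of\<close>, which contains forward iterates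
  only, act as a full cycle.\<close>

lemma permutes_closed_iff:
  assumes "f permutes S" "finite B" "f ` B \<subseteq> B"
  shows "f x \<in> B \<longleftrightarrow> x \<in> B"
proof -
  have "inj f" using assms(1) by (rule permutes_inj)
  moreover from this have "f ` B = B"
    using assms(2,3) by (simp add: endo_inj_surj inj_on_subset)
  ultimately show ?thesis by (metis inj_image_mem_iff)
qed

text \<open>The nontrivial inclusion walks backwards from y to x: the cycle of y is finite and
  closed, hence closed under preimages.\<close>

lemma cycle_of_eq:
  assumes f: "f permutes S" "finite S" and x: "x \<in> S" and y: "y \<in> cycle_of f x"
  shows "cycle_of f y = cycle_of f x"
proof
  show sub: "cycle_of f y \<subseteq> cycle_of f x"
    by (rule cycle_of_least[OF y cycle_of_closed])
  have "cycle_of f x \<subseteq> S"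
    using cycle_of_least x permutes_image[OF f(1)] by (metis order_refl)
  then have fin: "finite (cycle_of f y)"
    using sub f(2) by (meson finite_subset)
  obtain k where "y = (f ^^ k) x" using y by (auto simp: cycle_of_def)
  then have "(f ^^ k) x \<in> cycle_of f y" by (simp add: self_in_cycle_of)
  then have "x \<in> cycle_of f y"
    by (induction k) (auto simp: permutes_closed_iff[OF f(1) fin cycle_of_closed])
  then show "cycle_of f x \<subseteq> cycle_of f y"
    by (rule cycle_of_least[OF _ cycle_of_closed])
qed

text \<open>The cycle is the least closed set containing x. Trading it for any closed witness B
  means that the cycle of a modified permutation never has to be computed.\<close>

lemma cycle_of_disjoint_iff:
  "cycle_of f x \<inter> T = {} \<longleftrightarrow> (\<exists>B. x \<in> B \<and> f ` B \<subseteq> B \<and> B \<inter> T = {})"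
proof
  assume "cycle_of f x \<inter> T = {}"
  then show "\<exists>B. x \<in> B \<and> f ` B \<subseteq> B \<and> B \<inter> T = {}"
    using self_in_cycle_of cycle_of_closed by metis
next
  assume "\<exists>B. x \<in> B \<and> f ` B \<subseteq> B \<and> B \<inter> T = {}"
  then show "cycle_of f x \<inter> T = {}"
    using cycle_of_least by (metis Int_mono order_refl subset_empty)
qed

text \<open>Multiplying by a transposition with a fresh point inserts that point into a cycle.\<close>

lemma cycle_of_disjoint_insert:
  assumes "inj p" "p a = a" "z \<noteq> a" "a \<notin> T"
  shows "cycle_of (Transposition.transpose a b \<circ> p) z \<inter> T = {} \<longleftrightarrow> cycle_of p z \<inter> T = {}"
  unfolding cycle_of_disjoint_iff
proof
  let ?s = "Transposition.transpose a b \<circ> p"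
  assume "\<exists>B. z \<in> B \<and> ?s ` B \<subseteq> B \<and> B \<inter> T = {}"
  then obtain B where B: "z \<in> B" "\<And>x. x \<in> B \<Longrightarrow> Transposition.transpose a b (p x) \<in> B" "B \<inter> T = {}"
    by auto
  \<comment> \<open>The point \<open>a\<close> may be added because \<open>p\<close> fixes it. The
    critical case is \<open>p x = b\<close>: the modified permutation sends x to a and a to b, so
    closedness puts b into B.\<close>
  have "p x \<in> insert a B" if "x \<in> insert a B" for x
  proof (cases "x = a \<or> p x = a")
    case True then show ?thesis using assms by auto
  next
    case False
    then have x: "x \<in> B" using that by auto
    show ?thesis
    proof (cases "p x = b")
      case True
      then have "a \<in> B" using B(2)[OF x] by simp
      then show ?thesis using B(2)[of a] assms True by simp
    next
      case neq: False
      then show ?thesis using B(2)[OF x] False by (simp add: Transposition.transpose_def)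
    qed
  qed
  then show "\<exists>B. z \<in> B \<and> p ` B \<subseteq> B \<and> B \<inter> T = {}"
    using B assms by (intro exI[of _ "insert a B"]) auto
next
  let ?s = "Transposition.transpose a b \<circ> p"
  assume "\<exists>B. z \<in> B \<and> p ` B \<subseteq> B \<and> B \<inter> T = {}"
  then obtain B where B: "z \<in> B" "\<And>x. x \<in> B \<Longrightarrow> p x \<in> B" "B \<inter> T = {}"
    by auto
  \<comment> \<open>The modified permutation sends a to b, and sends the \<open>p\<close>-preimage
    of b to a. So a must join the witness when b lies in it and must leave it otherwise.\<close>
  show "\<exists>B. z \<in> B \<and> ?s ` B \<subseteq> B \<and> B \<inter> T = {}"
  proof (cases "b \<in> B")
    case True
    have "?s ` insert a B \<subseteq> insert a B"
      using B assms True by (auto simp: Transposition.transpose_def)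
    then show ?thesis using B assms by (intro exI[of _ "insert a B"]) auto
  next
    case False
    have "p x \<noteq> a" if "x \<noteq> a" for x
      using assms that by (metis injD)
    then have "?s ` (B - {a}) \<subseteq> B - {a}"
      using B False by (auto simp: Transposition.transpose_def)
    then show ?thesis using B assms by (intro exI[of _ "B - {a}"]) auto
  qed
qed

text \<open>Induction on the set R of points outside \<open>insert z T\<close>. If R is empty,
  avoiding T forces z to be fixed, which leaves the permutations of T. A new point a is inserted by
  composing with a transposition of a and an arbitrary b: each larger permutation arises once, and
  avoidance of T is unaffected, so both sides gain the same factor.\<close>

lemma card_cycle_avoids:
  assumes "finite S" "z \<in> S" "T \<subseteq> S" "z \<notin> T"
  shows "(card T + 1) * card {s. s permutes S \<and> cycle_of s z \<inter> T = {}} = fact (card S)"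
proof -
  have finT: "finite (insert z T)" using assms finite_subset by blast
  have "(card T + 1) * card {s. s permutes R \<union> insert z T \<and> cycle_of s z \<inter> T = {}}
      = fact (card (R \<union> insert z T))" if "finite R" "R \<inter> insert z T = {}" for R
    using that
  proof (induction R)
    case empty
    have "s z = z" if "s permutes insert z T" "cycle_of s z \<inter> T = {}" for s
    proof -
      have "s z \<in> cycle_of s z" using self_in_cycle_of cycle_of_closed by fast
      moreover have "s z \<in> insert z T" using permutes_in_image[of s "insert z T" z] that(1) by blast
      ultimately show ?thesis using that(2) by auto
    qed
    moreover have "cycle_of s z \<inter> T = {}" if "s z = z" for s
      using cycle_of_least[of z "{z}" s] that assms(4) by auto
    moreover have "s permutes T \<longleftrightarrow> s permutes insert z T \<and> s z = z" for s
      using assms(4) by (metis insertE permutes_not_in permutes_subset permutes_superset subset_insertI Diff_insert_absorb DiffE Diff_iff)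
    ultimately have "{s. s permutes {} \<union> insert z T \<and> cycle_of s z \<inter> T = {}} = {s. s permutes T}"
      by auto
    then show ?case using finT assms(4) by (simp add: card_permutations)
  next
    case (insert a R)
    let ?S = "R \<union> insert z T"
    let ?P = "\<lambda>S s. s permutes S \<and> cycle_of s z \<inter> T = {}"
    let ?g = "\<lambda>(b, p). Transposition.transpose a b \<circ> p"
    have a: "a \<notin> ?S" "z \<noteq> a" "a \<notin> T" and ins: "insert a R \<union> insert z T = insert a ?S"
      using insert by auto
    have avoid: "cycle_of (?g (b, p)) z \<inter> T = {} \<longleftrightarrow> cycle_of p z \<inter> T = {}" if "p permutes ?S" for b p
      using cycle_of_disjoint_insert[OF permutes_inj[OF that] permutes_not_in[OF that a(1)] a(2,3)]
      by simp
    have "{s. ?P (insert a ?S) s} = ?g ` (insert a ?S \<times> {p. ?P ?S p})"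
    proof -
      have "{s. s permutes insert a ?S} = ?g ` (insert a ?S \<times> {p. p permutes ?S})"
        by (subst permutes_insert) auto
      then have "{s. ?P (insert a ?S) s} =
          {s \<in> ?g ` (insert a ?S \<times> {p. p permutes ?S}). cycle_of s z \<inter> T = {}}"
        by auto
      also have "\<dots> = ?g ` (insert a ?S \<times> {p. ?P ?S p})"
      proof (intro equalityI subsetI)
        fix s assume "s \<in> {s \<in> ?g ` (insert a ?S \<times> {p. p permutes ?S}). cycle_of s z \<inter> T = {}}"
        then obtain b p where bp: "b \<in> insert a ?S" "p permutes ?S" "s = ?g (b, p)"
          "cycle_of (?g (b, p)) z \<inter> T = {}"
          by auto
        then have "(b, p) \<in> insert a ?S \<times> {p. ?P ?S p}" using avoid by blast
        then show "s \<in> ?g ` (insert a ?S \<times> {p. ?P ?S p})" unfolding bp(3) by (rule imageI)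
      next
        fix s assume "s \<in> ?g ` (insert a ?S \<times> {p. ?P ?S p})"
        then obtain b p where bp: "b \<in> insert a ?S" "?P ?S p" "s = ?g (b, p)" by auto
        then have "(b, p) \<in> insert a ?S \<times> {p. p permutes ?S}" by blast
        then have "s \<in> ?g ` (insert a ?S \<times> {p. p permutes ?S})" unfolding bp(3) by (rule imageI)
        moreover have "cycle_of s z \<inter> T = {}"
          unfolding bp(3) using avoid[of p b] bp(2) by metis
        ultimately show "s \<in> {s \<in> ?g ` (insert a ?S \<times> {p. p permutes ?S}). cycle_of s z \<inter> T = {}}"
          by (simp only: mem_Collect_eq)
      qed
      finally show ?thesis .
    qed
    moreover have "inj_on ?g (insert a ?S \<times> {p. ?P ?S p})"
    proof (rule inj_onI, clarify)
      fix b p c q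
      assume p: "p permutes ?S" and q: "q permutes ?S"
        and eq: "Transposition.transpose a b \<circ> p = Transposition.transpose a c \<circ> q"
      have "p a = a" "q a = a" using p q a by (auto intro: permutes_not_in)
      then have "b = c" using fun_cong[OF eq, of a] by simp
      moreover have "p = q" if "b = c"
      proof
        fix x show "p x = q x"
          using fun_cong[OF eq, of x] that
          by (metis comp_apply transpose_involutory)
      qed
      ultimately show "b = c \<and> p = q" by blast
    qed
    ultimately have card: "card {s. ?P (insert a ?S) s} = card (insert a ?S) * card {p. ?P ?S p}"
      by (simp add: card_image card_cartesian_product)
    have IH: "(card T + 1) * card {p. ?P ?S p} = fact (card ?S)"
      by (rule insert.IH) (use insert.prems in blast)
    have "(card T + 1) * card {s. ?P (insert a ?S) s} =
        card (insert a ?S) * ((card T + 1) * card {p. ?P ?S p})"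
      unfolding card by (rule mult.left_commute)
    also have "\<dots> = card (insert a ?S) * fact (card ?S)" unfolding IH ..
    also have "\<dots> = fact (card (insert a ?S))"
      using a(1) insert.hyps(1) finT by simp
    finally show ?case unfolding ins .
  qed
  from this[of "S - insert z T"] have "(card T + 1) *
      card {s. s permutes (S - insert z T) \<union> insert z T \<and> cycle_of s z \<inter> T = {}}
      = fact (card ((S - insert z T) \<union> insert z T))"
    using assms(1) by blast
  moreover have "(S - insert z T) \<union> insert z T = S" using assms by blast
  ultimately show ?thesis by (simp only:)
qed

section \<open>Intransitive pairs\<close>

text \<open>A stable finite set is mapped onto itself, so the permutation splits into one of B and
  one of \<open>S - B\<close>, and these two restrictions determine it.\<close>

lemma card_permutes_stable_le:
  assumes "finite S" "B \<subseteq> S"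
  shows "card {s. s permutes S \<and> s ` B \<subseteq> B} \<le> fact (card B) * fact (card (S - B))"
proof -
  let ?A = "{s. s permutes S \<and> s ` B \<subseteq> B}"
  let ?h = "\<lambda>s. (\<lambda>x. if x \<in> B then s x else x, \<lambda>x. if x \<in> B then x else s x)"
  have finB: "finite B" using assms finite_subset by blast
  have "inj_on ?h ?A"
  proof (rule inj_onI)
    fix s t assume eq: "?h s = ?h t"
    show "s = t"
    proof
      fix x
      show "s x = t x"
        using fun_cong[OF arg_cong[OF eq, of fst], of x] fun_cong[OF arg_cong[OF eq, of snd], of x]
        by (cases "x \<in> B") simp_all
    qed
  qed
  moreover have "?h ` ?A \<subseteq> {p. p permutes B} \<times> {p. p permutes S - B}"
  proof
    fix q assume "q \<in> ?h ` ?A"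
    then obtain s where s: "s permutes S" "s ` B \<subseteq> B" "q = ?h s" by blast
    have inj: "inj s" using s(1) by (rule permutes_inj)
    have B: "s ` B = B" using s(2) finB inj by (simp add: endo_inj_surj inj_on_subset)
    have "s ` (S - B) = S - B"
      using image_set_diff[OF inj, of S B] permutes_image[OF s(1)] B by simp
    then have "bij_betw s (S - B) (S - B)" "bij_betw s B B"
      using inj B by (auto simp: bij_betw_def intro: inj_on_subset)
    moreover have "bij_betw (\<lambda>x. if x \<in> B then x else s x) (S - B) (S - B) \<longleftrightarrow> bij_betw s (S - B) (S - B)"
      "bij_betw (\<lambda>x. if x \<in> B then s x else x) B B \<longleftrightarrow> bij_betw s B B"
      by (auto intro!: bij_betw_cong)
    ultimately have bij: "bij_betw (\<lambda>x. if x \<in> B then x else s x) (S - B) (S - B)"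
      "bij_betw (\<lambda>x. if x \<in> B then s x else x) B B" by blast+
    have "(\<lambda>x. if x \<in> B then x else s x) permutes S - B"
      by (rule bij_imp_permutes[OF bij(1)]) (use permutes_not_in[OF s(1)] in auto)
    moreover have "(\<lambda>x. if x \<in> B then s x else x) permutes B"
      by (rule bij_imp_permutes[OF bij(2)]) simp
    ultimately show "q \<in> {p. p permutes B} \<times> {p. p permutes S - B}"
      unfolding s(3) by (simp only: mem_Sigma_iff mem_Collect_eq simp_thms)
  qed
  moreover have "finite ({p. p permutes B} \<times> {p. p permutes S - B})"
    using assms finB by (simp add: finite_permutations)
  ultimately have "card ?A \<le> card ({p. p permutes B} \<times> {p. p permutes S - B})"
    by (rule card_inj_on_le)
  then show ?thesis
    using assms finB by (simp add: card_cartesian_product card_permutations)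
qed

text \<open>The end terms k = 1 and k = n - 1 are 1/n each. By unimodality every other term is at
  most the inverse of \<open>n choose 2\<close>, and n - 1 copies of that inverse add up to 2/n. The
  majorant counts both end contributions even when n = 2 and they coincide.\<close>

lemma sum_inverse_binomial_le:
  assumes "n \<ge> 2"
  shows "(\<Sum>k = 1..<n. 1 / real (n choose k)) \<le> 4 / real n"
proof -
  let ?c = "2 / (real n * (real n - 1))"
  have two: "real (n choose 2) = real n * (real n - 1) / 2"
    using assms by (simp add: choose_two real_of_nat_div of_nat_diff)
  have pos: "real n * (real n - 1) > 0" using assms by simp
  have "1 / real (n choose k) \<le>
      (if k = 1 then 1 / real n else 0) + (if k = n - 1 then 1 / real n else 0) + ?c"
    if "k \<in> {1..<n}" for k
  proof (cases "k = 1 \<or> k = n - 1")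
    case True
    have "n choose k = n"
      using True assms binomial_symmetric[of 1 n] by auto
    moreover have "?c \<ge> 0" using pos by simp
    ultimately show ?thesis using True by auto
  next
    case False
    then have k: "2 \<le> k" "k \<le> n - 2" "n \<ge> 4" using that by auto
    have "n choose 2 \<le> n choose k"
    proof (cases "2 * k \<le> n")
      case True then show ?thesis using k binomial_mono[of 2 k n] by simp
    next
      case False
      then have "n choose 2 \<le> n choose (n - k)" using k by (intro binomial_mono) auto
      then show ?thesis using k binomial_symmetric[of k n] by simp
    qed
    then have "1 / real (n choose k) \<le> 1 / real (n choose 2)"
      using k by (intro divide_left_mono) (auto simp: zero_less_binomial)
    also have "\<dots> = ?c" by (simp add: two)
    finally show ?thesis using False by simp
  qed
  then have "(\<Sum>k = 1..<n. 1 / real (n choose k)) \<le>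
      (\<Sum>k = 1..<n. (if k = 1 then 1 / real n else 0) + (if k = n - 1 then 1 / real n else 0) + ?c)"
    by (rule sum_mono)
  also have "\<dots> = 2 / real n + (real n - 1) * ?c"
    using assms by (simp only: sum.distrib sum.delta finite_atLeastLessThan) (simp add: of_nat_diff)
  also have "\<dots> = 4 / real n" using assms by (simp add: field_simps)
  finally show ?thesis .
qed

text \<open>The square is the single term i = k of the Vandermonde sum.\<close>

lemma binomial_square_le: "(n choose k)\<^sup>2 \<le> (2 * n) choose (2 * k)"
proof -
  have "(n choose k) * (n choose (2 * k - k)) \<le> (\<Sum>i\<le>2 * k. (n choose i) * (n choose (2 * k - i)))"
    by (rule member_le_sum) auto
  then show ?thesis by (simp add: vandermonde power2_eq_square mult_2)
qed

text \<open>Transitivity of the group generated by \<open>s\<close> and an involution with orbit set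
  E. A union of members of E is closed under the involution automatically, so only closedness under
  \<open>s\<close> is demanded.\<close>

definition indecomposable :: "'a set set \<Rightarrow> ('a \<Rightarrow> 'a) \<Rightarrow> bool" where
  "indecomposable E s \<longleftrightarrow> (\<forall>F\<subseteq>E. F \<noteq> {} \<longrightarrow> s ` \<Union>F \<subseteq> \<Union>F \<longrightarrow> F = E)"

text \<open>The counts depend on an involution only through its set of orbits, a perfect matching.
  The locale is instantiated both with the edges of a map and with the orbits of a
  permutation.\<close>

locale pairing =
  fixes S :: "'a set" and E :: "'a set set" and n :: nat
  assumes finite_E: "finite E" and card_E: "card E = n" and Union_E: "\<Union>E = S"
    and disj_E: "disjoint E" and card_pair: "e \<in> E \<Longrightarrow> card e = 2"
begin

lemma card_Union_pairs:
  assumes "F \<subseteq> E"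
  shows "finite (\<Union>F)" "card (\<Union>F) = 2 * card F"
proof -
  have fin: "finite e" if "e \<in> F" for e
    using card_pair[of e] that assms by (metis card.infinite subsetD zero_neq_numeral)
  moreover have "finite F" using assms finite_E finite_subset by blast
  ultimately show "finite (\<Union>F)" by blast
  have "card (\<Union>F) = sum card F"
    using assms disj_E fin by (intro card_Union_disjoint) (auto simp: pairwise_subset)
  also have "\<dots> = (\<Sum>e\<in>F. 2)" using assms card_pair by (intro sum.cong) auto
  finally show "card (\<Union>F) = 2 * card F" by simp
qed

lemma finite_S: "finite S" and card_S: "card S = 2 * n"
  using card_Union_pairs[of E] by (simp_all add: Union_E card_E)

text \<open>Union bound over the proper nonempty sets F of k edges. A given F has a stable union
  with probability at most the inverse of \<open>(2 * n) choose (2 * k)\<close>, and there are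
  \<open>n choose k\<close> such F; \<open>binomial_square_le\<close> reduces the product to the
  inverse of \<open>n choose k\<close>.\<close>

lemma card_decomposable_le:
  assumes "n \<ge> 2"
  shows "real (card {s. s permutes S \<and> \<not> indecomposable E s}) \<le> fact (2 * n) * 4 / real n"
proof -
  let ?bad = "\<lambda>F. {s. s permutes S \<and> s ` \<Union>F \<subseteq> \<Union>F}"
  let ?G = "{F. F \<subseteq> E \<and> F \<noteq> {} \<and> F \<noteq> E}"
  have finG: "finite ?G" using finite_E by simp
  have fin: "finite (?bad F)" for F
    using finite_permutations[OF finite_S] by (rule finite_subset[rotated]) auto
  have "{s. s permutes S \<and> \<not> indecomposable E s} \<subseteq> (\<Union>F\<in>?G. ?bad F)"
    unfolding indecomposable_def by blast
  then have "card {s. s permutes S \<and> \<not> indecomposable E s} \<le> card (\<Union>F\<in>?G. ?bad F)"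
    using finG fin by (intro card_mono) auto
  also have "\<dots> \<le> (\<Sum>F\<in>?G. card (?bad F))"
    using finG by (rule card_UN_le)
  finally have "real (card {s. s permutes S \<and> \<not> indecomposable E s}) \<le> (\<Sum>F\<in>?G. real (card (?bad F)))"
    unfolding of_nat_sum[symmetric] by (simp only: of_nat_le_iff)
  also have "\<dots> \<le> (\<Sum>F\<in>?G. fact (2 * n) / real ((2 * n) choose (2 * card F)))"
  proof (rule sum_mono)
    fix F assume F: "F \<in> ?G"
    then have le: "card F \<le> n" using finite_E card_E card_mono by blast
    have sub: "\<Union>F \<subseteq> S" using F Union_E by blast
    have "real (card (?bad F)) \<le> fact (card (\<Union>F)) * fact (card (S - \<Union>F))"
      using of_nat_mono[OF card_permutes_stable_le[OF finite_S sub], where 'a = real]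
      by (simp only: of_nat_fact of_nat_mult)
    also have "\<dots> = fact (2 * card F) * fact (2 * n - 2 * card F)"
      using F sub card_Union_pairs[of F] by (simp add: card_Diff_subset card_S)
    also have "\<dots> = fact (2 * n) / real ((2 * n) choose (2 * card F))"
      using le by (subst binomial_fact) auto
    finally show "real (card (?bad F)) \<le> fact (2 * n) / real ((2 * n) choose (2 * card F))" .
  qed
  also have "\<dots> = (\<Sum>k\<in>{1..<n}. \<Sum>F\<in>{F\<in>?G. card F = k}. fact (2 * n) / real ((2 * n) choose (2 * card F)))"
  proof (rule sum.group[symmetric])
    show "card ` ?G \<subseteq> {1..<n}"
    proof (rule image_subsetI)
      fix F assume "F \<in> ?G"
      then have F: "F \<subseteq> E" "F \<noteq> {}" "F \<noteq> E" by simp_all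
      have "card F < n" using F psubset_card_mono[OF finite_E] card_E by blast
      moreover have "card F \<noteq> 0" using F finite_E finite_subset by fastforce
      ultimately show "card F \<in> {1..<n}" by simp
    qed
  qed (use finG in auto)
  also have "\<dots> = (\<Sum>k\<in>{1..<n}. (n choose k) * (fact (2 * n) / real ((2 * n) choose (2 * k))))"
  proof (rule sum.cong[OF refl])
    fix k assume k: "k \<in> {1..<n}"
    have "{F\<in>?G. card F = k} = {F. F \<subseteq> E \<and> card F = k}" using k card_E by auto
    then show "(\<Sum>F\<in>{F\<in>?G. card F = k}. fact (2 * n) / real ((2 * n) choose (2 * card F)))
      = (n choose k) * (fact (2 * n) / real ((2 * n) choose (2 * k)))"
      using n_subsets[OF finite_E, of k] card_E by simp
  qed
  also have "\<dots> \<le> (\<Sum>k\<in>{1..<n}. fact (2 * n) * (1 / real (n choose k)))"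
  proof (rule sum_mono)
    fix k assume k: "k \<in> {1..<n}"
    have pos: "real (n choose k) > 0" using k by simp
    have "(real (n choose k))\<^sup>2 \<le> real ((2 * n) choose (2 * k))"
      using of_nat_mono[OF binomial_square_le[of n k], where 'a = real] by simp
    then have "real (n choose k) / real ((2 * n) choose (2 * k)) \<le> real (n choose k) / (real (n choose k))\<^sup>2"
      using pos k by (intro divide_left_mono) auto
    also have "\<dots> = 1 / real (n choose k)" using pos by (simp add: power2_eq_square)
    finally have "fact (2 * n) * (real (n choose k) / real ((2 * n) choose (2 * k))) \<le>
        fact (2 * n) * (1 / real (n choose k))" by (rule mult_left_mono) simp
    then show "(n choose k) * (fact (2 * n) / real ((2 * n) choose (2 * k))) \<le>
        fact (2 * n) * (1 / real (n choose k))" by (simp add: mult.commute)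
  qed
  also have "\<dots> \<le> fact (2 * n) * (4 / real n)"
    unfolding sum_distrib_left[symmetric] by (intro mult_left_mono sum_inverse_binomial_le assms) simp
  finally show ?thesis by simp
qed

end

section \<open>Moments of the number of missed edges\<close>

text \<open>The product \<open>fact m * (x choose m)\<close> is the falling factorial x (x - 1) ...
  (x - m + 1). Passing from m to m + 1 adds m to the constant, and m^2 + m is at most (m + 1)^2. The
  factor n on the left avoids the exponent m - 1.\<close>

lemma falling_factorial_approx:
  assumes "x \<le> n"
  shows "fact m * real (x choose m) \<le> real x ^ m"
    and "real n * (real x ^ m - fact m * real (x choose m)) \<le> (real m)\<^sup>2 * real n ^ m"
proof (induction m)
  case 0
  { case 1 show ?case by simp next case 2 show ?case by simp }
next
  case (Suc m)
  let ?F = "\<lambda>m. fact m * real (x choose m)"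
  have "Suc m * (x choose Suc m) = (x - m) * (x choose m)"
    by (simp only: binomial_absorption binomial_absorb_comp)
  then have "real (Suc m) * real (x choose Suc m) = real (x - m) * real (x choose m)"
    by (simp only: of_nat_mult[symmetric])
  \<comment> \<open>For x < m the natural-number difference is truncated, but then the binomial
    coefficient vanishes.\<close>
  also have "\<dots> = (real x - real m) * real (x choose m)"
    by (cases "m \<le> x") (simp_all add: of_nat_diff binomial_eq_0)
  finally have rec: "?F (Suc m) = (real x - real m) * ?F m"
    by (simp only: fact_Suc mult_ac of_nat_Suc)
  have pos: "?F m \<ge> 0" by simp
  { case 1
    have "?F (Suc m) \<le> real x * ?F m" unfolding rec using pos by (intro mult_right_mono) auto
    also have "\<dots> \<le> real x * real x ^ m" using Suc(1) by (intro mult_left_mono) auto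
    finally show ?case by simp
  next
    case 2
    have "real n * (real x ^ Suc m - ?F (Suc m)) =
        real x * (real n * (real x ^ m - ?F m)) + real n * real m * ?F m"
      unfolding rec by (simp add: algebra_simps)
    also have "\<dots> \<le> real n * ((real m)\<^sup>2 * real n ^ m) + real n * real m * real n ^ m"
    proof (intro add_mono mult_left_mono)
      show "real x * (real n * (real x ^ m - ?F m)) \<le> real n * ((real m)\<^sup>2 * real n ^ m)"
        by (rule mult_mono) (use Suc assms in auto)
      show "?F m \<le> real n ^ m"
        using Suc(1) power_mono[of "real x" "real n" m] assms by simp
    qed simp
    also have "\<dots> = ((real m)\<^sup>2 + real m) * real n ^ Suc m" by (simp add: algebra_simps)
    also have "\<dots> \<le> (real (Suc m))\<^sup>2 * real n ^ Suc m"
      by (intro mult_right_mono) (auto simp: power2_eq_square algebra_simps)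
    finally show ?case .
  }
qed

text \<open>For the rotation \<open>s\<close> and the root half-edge \<open>z\<close> of a map these
  are the edges that miss the root vertex.\<close>

definition avoiding :: "'a set set \<Rightarrow> 'a \<Rightarrow> ('a \<Rightarrow> 'a) \<Rightarrow> 'a set set" where
  "avoiding E z s = {e \<in> E. cycle_of s z \<inter> e = {}}"

context pairing
begin

lemma card_avoiding_le: "card (avoiding E z s) \<le> n"
  unfolding avoiding_def card_E[symmetric] using finite_E by (intro card_mono) auto

text \<open>Double counting of pairs of a permutation and a set F of m avoided edges. The edge e
  through z is never avoided, so F is chosen among the other n - 1 edges, and avoiding F means
  avoiding the 2m points of its union.\<close>

lemma sum_choose_avoiding:
  assumes "z \<in> S"
  shows "(2 * m + 1) * (\<Sum>s | s permutes S. card (avoiding E z s) choose m)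
    = fact (2 * n) * ((n - 1) choose m)"
proof -
  obtain e where e: "e \<in> E" "z \<in> e" using assms Union_E by blast
  let ?G = "{F. F \<subseteq> E - {e} \<and> card F = m}"
  let ?P = "{s. s permutes S}"
  have finP: "finite ?P" by (rule finite_permutations[OF finite_S])
  have finG: "finite ?G" using finite_E by simp
  have "card (avoiding E z s) choose m = (\<Sum>F\<in>?G. if cycle_of s z \<inter> \<Union>F = {} then 1 else 0)" for s
  proof -
    have "finite (avoiding E z s)" using finite_E by (simp add: avoiding_def)
    then have "card (avoiding E z s) choose m = card {F. F \<subseteq> avoiding E z s \<and> card F = m}"
      by (simp add: n_subsets)
    also have "e \<notin> avoiding E z s" using e self_in_cycle_of[of z s] by (auto simp: avoiding_def)
    then have "{F. F \<subseteq> avoiding E z s \<and> card F = m} = {F \<in> ?G. cycle_of s z \<inter> \<Union>F = {}}"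
      unfolding avoiding_def by blast
    finally show ?thesis using finG by (simp add: sum.If_cases Int_def)
  qed
  moreover have count: "(\<Sum>s\<in>?P. if cycle_of s z \<inter> \<Union>F = {} then 1 else 0) =
      card {s. s permutes S \<and> cycle_of s z \<inter> \<Union>F = {}}" for F
    using finP by (simp add: sum.If_cases Int_def)
  ultimately have "(2 * m + 1) * (\<Sum>s\<in>?P. card (avoiding E z s) choose m)
      = (2 * m + 1) * (\<Sum>s\<in>?P. \<Sum>F\<in>?G. if cycle_of s z \<inter> \<Union>F = {} then 1 else 0)"
    by simp
  also have "\<dots> = (2 * m + 1) * (\<Sum>F\<in>?G. \<Sum>s\<in>?P. if cycle_of s z \<inter> \<Union>F = {} then 1 else 0)"
    by (subst sum.swap) (rule refl)
  also have "\<dots> = (\<Sum>F\<in>?G. (2 * m + 1) * card {s. s permutes S \<and> cycle_of s z \<inter> \<Union>F = {}})"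
    by (simp only: count sum_distrib_left)
  also have "\<dots> = (\<Sum>F\<in>?G. fact (2 * n))"
  proof (rule sum.cong[OF refl])
    fix F assume F: "F \<in> ?G"
    have sub: "\<Union>F \<subseteq> S" using F Union_E by blast
    have "z \<notin> \<Union>F"
    proof
      assume "z \<in> \<Union>F"
      then obtain d where "d \<in> F" "z \<in> d" by blast
      then show False using e F disj_E unfolding pairwise_def disjnt_def by blast
    qed
    moreover have "card (\<Union>F) = 2 * m" using F card_Union_pairs[of F] by auto
    ultimately show "(2 * m + 1) * card {s. s permutes S \<and> cycle_of s z \<inter> \<Union>F = {}} = fact (2 * n)"
      using card_cycle_avoids[OF finite_S assms sub] by (simp only: card_S not_False_eq_True simp_thms)
  qed
  also have "\<dots> = fact (2 * n) * ((n - 1) choose m)"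
    using n_subsets[of "E - {e}" m] finite_E e card_E by simp
  finally show ?thesis .
qed

text \<open>Binomial moments are exact, so the error comes from comparing powers with falling
  factorials. This costs m^2/n twice, once under the sum and once at n - 1, and replacing the m-th
  power of (n - 1)/n by 1 costs another m/n.\<close>

lemma moment_avoiding:
  assumes "z \<in> S"
  shows "\<bar>(\<Sum>s | s permutes S. (real (card (avoiding E z s)) / n) ^ m) - fact (2 * n) / real (2 * m + 1)\<bar>
    \<le> fact (2 * n) * (2 * (real m)\<^sup>2 + m) / n"
proof -
  let ?P = "{s. s permutes S}"
  have n: "n > 0" using assms card_S finite_S by (metis card_gt_0_iff empty_iff gr0I mult_0_right)
  have cardP: "real (card ?P) = fact (2 * n)"
    using finite_S by (simp add: card_permutations card_S)
  let ?G = "\<lambda>x. fact m * real (x choose m) / real n ^ m"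
  have approx: "\<bar>(real x / n) ^ m - ?G x\<bar> \<le> (real m)\<^sup>2 / n" if "x \<le> n" for x
  proof -
    have "(real x / n) ^ m - ?G x = (real n * (real x ^ m - fact m * real (x choose m))) / (real n * real n ^ m)"
      using n by (simp add: power_divide diff_divide_distrib)
    also have "\<dots> \<le> ((real m)\<^sup>2 * real n ^ m) / (real n * real n ^ m)"
      using falling_factorial_approx(2)[OF that] by (rule divide_right_mono) simp
    also have "\<dots> = (real m)\<^sup>2 / n" using n by simp
    finally have "(real x / n) ^ m - ?G x \<le> (real m)\<^sup>2 / n" .
    moreover have "(real x / n) ^ m - ?G x \<ge> 0"
      using falling_factorial_approx(1)[OF that, of m] n by (simp add: power_divide divide_right_mono)
    ultimately show ?thesis by simp
  qed
  have "real (2 * m + 1) * (\<Sum>s\<in>?P. real (card (avoiding E z s) choose m)) = fact (2 * n) * real ((n - 1) choose m)"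
    using arg_cong[OF sum_choose_avoiding[OF assms, of m], of real] by (simp only: of_nat_mult of_nat_sum of_nat_fact)
  then have "(\<Sum>s\<in>?P. real (card (avoiding E z s) choose m)) = fact (2 * n) * real ((n - 1) choose m) / (2 * m + 1)"
    by (simp add: field_simps)
  then have G: "(\<Sum>s\<in>?P. ?G (card (avoiding E z s))) = fact (2 * n) * ?G (n - 1) / (2 * m + 1)"
    by (simp add: sum_divide_distrib[symmetric] sum_distrib_left[symmetric] mult_ac)
  have "\<bar>(\<Sum>s\<in>?P. (real (card (avoiding E z s)) / n) ^ m) - (\<Sum>s\<in>?P. ?G (card (avoiding E z s)))\<bar>
      \<le> (\<Sum>s\<in>?P. (real m)\<^sup>2 / n)"
    unfolding sum_subtractf[symmetric]
    by (rule order.trans[OF sum_abs]) (intro sum_mono approx card_avoiding_le)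
  then have 1: "\<bar>(\<Sum>s\<in>?P. (real (card (avoiding E z s)) / n) ^ m) - fact (2 * n) * ?G (n - 1) / (2 * m + 1)\<bar>
      \<le> fact (2 * n) * (real m)\<^sup>2 / n"
    unfolding G by (simp add: cardP)
  have "1 - real m / n \<le> (1 - 1 / real n) ^ m"
    using Bernoulli_inequality[of "- 1 / real n" m] n by simp
  moreover have "(1 - 1 / real n) = real (n - 1) / n" using n by (simp add: field_simps of_nat_diff)
  moreover have "(real (n - 1) / n) ^ m \<le> 1" using n by (intro power_le_one) auto
  ultimately have "\<bar>?G (n - 1) - 1\<bar> \<le> (real m)\<^sup>2 / n + m / n"
    using approx[of "n - 1"] by (simp add: abs_le_iff)
  then have "fact (2 * n) / (2 * m + 1) * \<bar>?G (n - 1) - 1\<bar> \<le> fact (2 * n) * ((real m)\<^sup>2 / n + m / n)"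
    by (intro mult_mono) (auto simp: divide_le_eq)
  moreover have "\<bar>fact (2 * n) * ?G (n - 1) / (2 * m + 1) - fact (2 * n) / (2 * m + 1)\<bar>
      = fact (2 * n) / (2 * m + 1) * \<bar>?G (n - 1) - 1\<bar>"
  proof -
    have "fact (2 * n) * ?G (n - 1) / (2 * m + 1) - fact (2 * n) / (2 * m + 1)
      = fact (2 * n) / (2 * m + 1) * (?G (n - 1) - 1)" by (simp add: algebra_simps)
    then show ?thesis by (simp add: abs_mult)
  qed
  ultimately have "\<bar>fact (2 * n) * ?G (n - 1) / (2 * m + 1) - fact (2 * n) / (2 * m + 1)\<bar>
      \<le> fact (2 * n) * ((real m)\<^sup>2 / n + m / n)" by simp
  then have "\<bar>(\<Sum>s\<in>?P. (real (card (avoiding E z s)) / n) ^ m) - fact (2 * n) / (2 * m + 1)\<bar>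
      \<le> fact (2 * n) * (real m)\<^sup>2 / n + fact (2 * n) * ((real m)\<^sup>2 / n + m / n)"
    using 1 by linarith
  also have "\<dots> = fact (2 * n) * (2 * (real m)\<^sup>2 + m) / n"
    by (simp add: algebra_simps add_divide_distrib)
  finally show ?thesis .
qed

end

section \<open>Convergence of moments\<close>

text \<open>Convergence on the functions \<open>cts_step\<close> suffices, and on the compact
  interval these are uniform limits of polynomials, whose integrals are combinations of moments.
  Powers of \<open>c - x\<close> let the moments of the missed fraction be used directly. The
  support condition on \<open>M n\<close> is eventual because the laws of interest are controlled
  only for large n.\<close>

lemma weak_conv_moments_compact:
  fixes M :: "nat \<Rightarrow> real measure" and N :: "real measure"
  assumes M: "\<And>n. real_distribution (M n)" "\<forall>\<^sub>F n in sequentially. AE x in M n. x \<in> {a..b}"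
    and N: "real_distribution N" "AE x in N. x \<in> {a..b}"
    and moments: "\<And>m. (\<lambda>n. \<integral>x. (c - x) ^ m \<partial>M n) \<longlonglongrightarrow> (\<integral>x. (c - x) ^ m \<partial>N)"
  shows "weak_conv_m M N"
proof (rule integral_cts_step_conv_imp_weak_conv[OF M(1) N(1)])
  fix x y :: real assume xy: "x < y"
  let ?f = "cts_step x y"
  have cont: "continuous_on A ?f" for A
    using uniformly_continuous_imp_continuous[OF cts_step_uniformly_continuous[OF xy]]
    by (rule continuous_on_subset) simp
  have int: "integrable L f" if L: "real_distribution L" "AE x in L. x \<in> {a..b}"
    and f: "continuous_on UNIV f" for L and f :: "real \<Rightarrow> real"
  proof -
    interpret L: real_distribution L by (rule L(1))
    have "bounded (f ` {a..b})"
      by (intro compact_imp_bounded compact_continuous_image continuous_on_subset[OF f]) auto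
    then obtain B where "\<And>x. x \<in> {a..b} \<Longrightarrow> norm (f x) \<le> B"
      unfolding bounded_iff by (metis image_eqI)
    then have "AE x in L. norm (f x) \<le> B" using L(2) by auto
    moreover have "f \<in> borel_measurable L"
      using borel_measurable_continuous_onI[OF f] L.events_eq_borel measurable_cong_sets by blast
    ultimately show ?thesis by (rule L.integrable_const_bound)
  qed
  show "(\<lambda>n. \<integral>t. ?f t \<partial>M n) \<longlonglongrightarrow> (\<integral>t. ?f t \<partial>N)"
  proof (rule LIMSEQ_I)
    fix r :: real assume r: "r > 0"
    \<comment> \<open>Approximating the reflected function on the reflected interval makes
      \<open>g (c - t)\<close> a combination of exactly the powers whose integrals are assumed to
      converge.\<close>
    have "continuous_on {c - b..c - a} (\<lambda>t. ?f (c - t))"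
      by (intro continuous_on_compose2[OF cont[of UNIV]] continuous_intros) auto
    then obtain g where g: "real_polynomial_function g"
      "\<And>t. t \<in> {c - b..c - a} \<Longrightarrow> \<bar>?f (c - t) - g t\<bar> < r / 3"
      using Stone_Weierstrass_real_polynomial_function[of "{c - b..c - a}" "\<lambda>t. ?f (c - t)" "r / 3"] r
      by auto
    obtain w d where gs: "g = (\<lambda>t. \<Sum>i\<le>d. w i * t ^ i)"
      using g(1) unfolding real_polynomial_function_iff_sum by blast
    have contg: "continuous_on UNIV (\<lambda>t. g (c - t))"
      unfolding gs by (intro continuous_intros)
    have close: "\<bar>(\<integral>t. ?f t \<partial>L) - (\<integral>t. g (c - t) \<partial>L)\<bar> \<le> r / 3"
      if L: "real_distribution L" "AE x in L. x \<in> {a..b}" for L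
    proof -
      interpret L: real_distribution L by (rule L(1))
      have i: "integrable L ?f" "integrable L (\<lambda>t. g (c - t))"
        by (intro int L cont contg)+
      have "\<bar>(\<integral>t. ?f t \<partial>L) - (\<integral>t. g (c - t) \<partial>L)\<bar> = \<bar>\<integral>t. ?f t - g (c - t) \<partial>L\<bar>"
        using i by simp
      also have "\<dots> \<le> (\<integral>t. \<bar>?f t - g (c - t)\<bar> \<partial>L)" by (rule integral_abs_bound)
      also have "\<dots> \<le> (\<integral>t. r / 3 \<partial>L)"
      proof (rule integral_mono_AE)
        show "AE t in L. \<bar>?f t - g (c - t)\<bar> \<le> r / 3"
          using L(2)
        proof eventually_elim
          case (elim t)
          then show ?case using g(2)[of "c - t"] by simp
        qed
      qed (use i in auto)
      also have "\<dots> = r / 3" using L.prob_space by simp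
      finally show ?thesis .
    qed
    have poly: "(\<integral>t. g (c - t) \<partial>L) = (\<Sum>i\<le>d. w i * (\<integral>t. (c - t) ^ i \<partial>L))"
      if L: "real_distribution L" "AE x in L. x \<in> {a..b}" for L
      unfolding gs by (subst Bochner_Integration.integral_sum) (auto intro!: int L continuous_intros)
    obtain n1 where n1: "\<And>n. n \<ge> n1 \<Longrightarrow> AE x in M n. x \<in> {a..b}"
      using M(2) unfolding eventually_sequentially by blast
    have "(\<lambda>n. \<Sum>i\<le>d. w i * (\<integral>t. (c - t) ^ i \<partial>M n)) \<longlonglongrightarrow> (\<integral>t. g (c - t) \<partial>N)"
      unfolding poly[OF N] by (intro tendsto_intros moments)
    moreover have "\<forall>\<^sub>F n in sequentially. (\<Sum>i\<le>d. w i * (\<integral>t. (c - t) ^ i \<partial>M n)) = (\<integral>t. g (c - t) \<partial>M n)"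
      using M(2) by eventually_elim (simp add: poly[OF M(1)])
    ultimately have "(\<lambda>n. \<integral>t. g (c - t) \<partial>M n) \<longlonglongrightarrow> (\<integral>t. g (c - t) \<partial>N)"
      by (rule Lim_transform_eventually)
    from LIMSEQ_D[OF this, of "r / 3"] r
    obtain n0 where n0: "\<And>n. n \<ge> n0 \<Longrightarrow> \<bar>(\<integral>t. g (c - t) \<partial>M n) - (\<integral>t. g (c - t) \<partial>N)\<bar> < r / 3"
      by auto
    show "\<exists>n0. \<forall>n\<ge>n0. norm ((\<integral>t. ?f t \<partial>M n) - (\<integral>t. ?f t \<partial>N)) < r"
    proof (intro exI allI impI)
      fix n assume "n \<ge> max n0 n1"
      then show "norm ((\<integral>t. ?f t \<partial>M n) - (\<integral>t. ?f t \<partial>N)) < r"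
        using close[OF M(1) n1, of n] close[OF N] n0[of n] unfolding real_norm_def max.bounded_iff by argo
    qed
  qed
qed

text \<open>All three claims use the integral of (1 - t)^m against the density: m = 0 gives total
  mass one, and general m gives the moments.\<close>

lemma
  shows real_distribution_beta: "real_distribution (beta_distribution 1 (1/2))" (is ?A)
    and AE_beta: "AE t in beta_distribution 1 (1/2). t \<in> {0..1}" (is ?B)
    and moment_beta: "(\<integral>t. (1 - t) ^ m \<partial>beta_distribution 1 (1/2)) = 1 / real (2 * m + 1)" (is ?C)
proof -
  let ?w = "\<lambda>t::real. if 0 \<le> t \<and> t < 1 then 1/2 * (1 - t) powr (-1/2) else 0"
  have I: "((\<lambda>t. (1 - t) ^ m * ?w t) has_integral 1 / real (2 * m + 1)) UNIV" for m
  proof -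
    \<comment> \<open>Differentiation produces the factor m + 1/2, and (m + 1/2) / (2m + 1) = 1/2 is
      the constant of the density.\<close>
    let ?F = "\<lambda>t::real. - ((1 - t) powr (m + 1/2)) / real (2 * m + 1)"
    have "((\<lambda>t. (1 - t) ^ m * ?w t) has_integral ?F 1 - ?F 0) {0..1}"
    \<comment> \<open>For m = 0 the antiderivative is a multiple of the square root of 1 - t and is
      not differentiable at 1, so differentiability is asked for in the interior only.\<close>
    proof (rule fundamental_theorem_of_calculus_interior)
      show "continuous_on {0..1} ?F" 
        by (intro continuous_on_divide continuous_on_minus continuous_on_powr' continuous_on_diff
            continuous_on_id continuous_on_const) (auto simp: add_nonneg_eq_0_iff)
      fix t :: real assume t: "t \<in> {0<..<1}"
      have "(?F has_real_derivative ((m + 1/2) * (1 - t) powr (m + 1/2 - 1)) / real (2 * m + 1)) (at t)"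
      proof -
        have "((\<lambda>t. (1 - t) powr (m + 1/2)) has_real_derivative
            (m + 1/2) * (1 - t) powr (m + 1/2 - 1) * (0 - 1)) (at t)"
          using t by (intro DERIV_fun_powr[where r = "m + 1/2", simplified of_nat_1] DERIV_diff DERIV_const DERIV_ident) auto
        from DERIV_cdivide[OF DERIV_minus[OF this]] show ?thesis by simp
      qed
      moreover have "((m + 1/2) * (1 - t) powr (m + 1/2 - 1)) / real (2 * m + 1) = (1 - t) ^ m * ?w t"
      proof -
        have "(1 - t) powr (m + 1/2 - 1) = (1 - t) powr m * (1 - t) powr (-1/2)"
          by (simp flip: powr_add)
        also have "(1 - t) powr m = (1 - t) ^ m" using t by (simp add: powr_realpow)
        finally show ?thesis using t by (simp add: field_simps)
      qed
      ultimately show "(?F has_vector_derivative (1 - t) ^ m * ?w t) (at t)"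
        by (simp add: has_real_derivative_iff_has_vector_derivative)
    qed simp
    then have "((\<lambda>t. (1 - t) ^ m * ?w t) has_integral 1 / real (2 * m + 1)) {0..1}" by simp
    moreover have "(1 - t) ^ m * ?w t = 0" if "t \<notin> {0..1}" for t using that by auto
    ultimately show ?thesis
      by (rule has_integral_on_superset) (assumption, rule subset_UNIV)
  qed
  have nonneg: "(1 - t) ^ m * ?w t \<ge> 0" for t m by simp
  have meas[measurable]: "?w \<in> borel_measurable borel" by measurable
  have D: "beta_distribution 1 (1/2) = density lborel (\<lambda>t. ennreal (?w t))"
    by (rule beta_distribution_1_half)
  have nn: "(\<integral>\<^sup>+ t. ennreal ((1 - t) ^ m * ?w t) \<partial>lborel) = ennreal (1 / real (2 * m + 1))" for m
    by (rule nn_integral_has_integral_lborel[OF _ nonneg I]) measurable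
  have "emeasure (density lborel (\<lambda>t. ennreal (?w t))) (space (density lborel (\<lambda>t. ennreal (?w t)))) = 1"
    using nn[of 0] by (simp add: emeasure_density)
  then have "prob_space (density lborel (\<lambda>t. ennreal (?w t)))" by (rule prob_spaceI)
  then show ?A unfolding D real_distribution_def real_distribution_axioms_def by simp
  show ?B unfolding D by (subst AE_density) (auto split: if_splits)
  have "(\<integral>t. (1 - t) ^ m \<partial>density lborel (\<lambda>t. ennreal (?w t))) = (\<integral>t. ?w t * (1 - t) ^ m \<partial>lborel)"
    by (subst integral_density) auto
  also have "\<dots> = enn2real (\<integral>\<^sup>+ t. ennreal ((1 - t) ^ m * ?w t) \<partial>lborel)"
    using nonneg by (subst integral_eq_nn_integral) (auto simp: mult.commute)
  also have "\<dots> = 1 / real (2 * m + 1)" unfolding nn by simp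
  finally show ?C unfolding D .
qed

section \<open>Maps as pairs of permutations\<close>

lemma pairing_edges:
  assumes "is_multigraph M"
  shows "pairing (halves M) (edges M) (card (edges M))"
proof
  have M: "\<And>h. h \<in> halves M \<Longrightarrow> mate M h \<in> halves M \<and> mate M h \<noteq> h \<and> mate M (mate M h) = h"
    and fin: "finite (halves M)"
    using assms by (auto simp: is_multigraph_def)
  have E: "edges M = (\<lambda>h. {h, mate M h}) ` halves M" by (auto simp: edges_def)
  show "finite (edges M)" unfolding E using fin by simp
  show "card (edges M) = card (edges M)" ..
  show "\<Union>(edges M) = halves M" unfolding E using M by auto
  show "disjoint (edges M)"
  proof (rule disjointI)
    fix d e assume "d \<in> edges M" "e \<in> edges M" and de: "d \<noteq> e"
    then obtain h k where hk: "h \<in> halves M" "k \<in> halves M" "d = {h, mate M h}" "e = {k, mate M k}"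
      unfolding E by blast
    have "{h, mate M h} = {x, mate M x}" if "h \<in> halves M" "x \<in> {h, mate M h}" for h x
      using M[OF that(1)] that(2) by auto
    then have "d = e" if "x \<in> d" "x \<in> e" for x
      using hk that by metis
    then show "d \<inter> e = {}" using de by blast
  qed
  show "card e = 2" if "e \<in> edges M" for e
    using that M unfolding E by (metis (no_types, lifting) card_2_iff imageE)
qed

text \<open>Vertices thereby become cycles of the rotation, so incidence can be recovered from
  \<open>rot\<close> alone.\<close>

lemma cyclic_halves:
  assumes "is_map M" "h \<in> halves M" "h' \<in> halves M"
  shows "base M h = base M h' \<longleftrightarrow> (\<exists>k. (rot M ^^ k) h = h')"
proof
  assume "base M h = base M h'"
  then have "h \<in> halves_at M (base M h)" "h' \<in> halves_at M (base M h)"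
    using assms by (auto simp: halves_at_def)
  moreover have "cyclic_on (rot M) (halves_at M (base M h))"
    using assms map_half_edge_closed(1)[OF assms(1,2)] by (simp add: is_map_def)
  ultimately show "\<exists>k. (rot M ^^ k) h = h'" by (simp add: cyclic_on_def)
next
  assume "\<exists>k. (rot M ^^ k) h = h'"
  then obtain k where k: "(rot M ^^ k) h = h'" ..
  have "cyclic_on (rot M) (halves_at M (base M h))"
    using assms map_half_edge_closed(1)[OF assms(1,2)] by (simp add: is_map_def)
  then have img: "rot M ` halves_at M (base M h) = halves_at M (base M h)"
    by (simp add: cyclic_on_def bij_betw_def)
  have "(rot M ^^ k) h \<in> halves_at M (base M h)"
  proof (induction k)
    case 0 then show ?case using assms by (simp add: halves_at_def)
  next
    case (Suc k)
    then have "rot M ((rot M ^^ k) h) \<in> rot M ` halves_at M (base M h)" by (rule imageI)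
    then show ?case by (simp add: img)
  qed
  then show "base M h = base M h'" unfolding k by (simp add: halves_at_def)
qed

lemma funpow_rot_halves:
  assumes "is_map M" "h \<in> halves M"
  shows "(rot M ^^ k) h \<in> halves M"
  using assms by (induction k) (simp_all add: map_half_edge_closed)

lemma map_rot_base:
  assumes "is_map M" "h \<in> halves M"
  shows "base M (rot M h) = base M h"
proof -
  have "\<exists>k. (rot M ^^ k) h = rot M h" by (rule exI[of _ 1]) simp
  then show ?thesis using cyclic_halves[OF assms map_half_edge_closed(3)[OF assms]] by metis
qed

text \<open>A path that reaches v from another vertex ends with an edge that has a half-edge at
  v.\<close>

lemma halves_at_nonempty:
  assumes M: "is_map M" and "halves M \<noteq> {}" "v \<in> verts M"
  shows "halves_at M v \<noteq> {}"
proof -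
  obtain h where h: "h \<in> halves M" using assms by blast
  show ?thesis
  proof (cases "base M h = v")
    case True then show ?thesis using h by (auto simp: halves_at_def)
  next
    case False
    have "(base M h, v) \<in> (adjacency M)\<^sup>*"
      using M map_half_edge_closed(1)[OF M h] assms(3) by (simp add: is_map_def is_connected_def)
    then obtain u where "(u, v) \<in> adjacency M" using False by (meson rtranclE)
    then show ?thesis
      using map_half_edge_closed(2)[OF M] by (auto simp: adjacency_def halves_at_def)
  qed
qed

text \<open>Closedness under the rotation spreads the union of F to all half-edges at a vertex,
  since these form one cycle. It is closed under \<open>mate\<close> because F consists of whole
  edges, so connectivity carries it along paths to every half-edge.\<close>

lemma map_indecomposable:
  assumes M: "is_map M"
  shows "indecomposable (edges M) (rot M)"
  unfolding indecomposable_def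
proof (intro allI impI)
  interpret pairing "halves M" "edges M" "card (edges M)"
    using M pairing_edges by (auto simp: is_map_def)
  fix F assume F: "F \<subseteq> edges M" "F \<noteq> {}" "rot M ` \<Union>F \<subseteq> \<Union>F"
  have sub: "\<Union>F \<subseteq> halves M" using F Union_E by blast
  have rot: "(rot M ^^ k) h \<in> \<Union>F" if "h \<in> \<Union>F" for h k
    using that F(3) by (induction k) auto
  have same: "k \<in> \<Union>F" if "h \<in> \<Union>F" "k \<in> halves M" "base M h = base M k" for h k
    using cyclic_halves[OF M, of h k] that sub rot[OF that(1)] by blast
  have inv: "\<And>h. h \<in> halves M \<Longrightarrow> mate M (mate M h) = h"
    using M by (simp add: is_map_def is_multigraph_def)
  have mate: "mate M h \<in> \<Union>F" if "h \<in> \<Union>F" for h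
  proof -
    obtain e where e: "e \<in> F" "h \<in> e" using \<open>h \<in> \<Union>F\<close> by blast
    then obtain k where "k \<in> halves M" "e = {k, mate M k}" using F(1) by (auto simp: edges_def)
    then have "mate M h \<in> e" using e inv by auto
    then show ?thesis using e by blast
  qed
  obtain e h0 where h0: "e \<in> F" "h0 \<in> e"
    using F(1,2) card_pair by (metis all_not_in_conv card.empty subsetD zero_neq_numeral)
  then have h0F: "h0 \<in> \<Union>F" "h0 \<in> halves M" using sub by blast+
  have reach: "\<forall>h\<in>halves M. base M h = v \<longrightarrow> h \<in> \<Union>F"
    if "(base M h0, v) \<in> (adjacency M)\<^sup>*" for v
    using that
  proof (induction rule: rtrancl_induct)
    case base
    show ?case using same h0F(1) by metis
  next
    case (step u v)
    then obtain h where h: "h \<in> halves M" "base M h = u" "base M (mate M h) = v"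
      by (auto simp: adjacency_def)
    then have "mate M h \<in> \<Union>F" using step mate by blast
    then show ?case using same h(3) by metis
  qed
  have "h \<in> \<Union>F" if "h \<in> halves M" for h
    using reach[of "base M h"] that M map_half_edge_closed(1)[OF M] h0F(2)
    by (simp add: is_map_def is_connected_def)
  then have "\<Union>F = halves M" using sub by blast
  then have "card F = card (edges M)" using card_Union_pairs(2)[OF F(1)] card_S by simp
  then show "F = edges M" using F(1) finite_E by (simp add: card_subset_eq)
qed

text \<open>The vertex map is forced: v goes to the base of \<open>g h\<close> for any half-edge h
  at v. The choice of h does not matter because sharing a vertex means sharing a rotation cycle, and
  \<open>g\<close> preserves these cycles.\<close>

lemma rooted_iso_of_halves:
  assumes R: "is_rooted_map R" and S: "is_rooted_map S"
    and g: "bij_betw g (halves (fst R)) (halves (fst S))"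
    and comm: "\<And>h. h \<in> halves (fst R) \<Longrightarrow> mate (fst S) (g h) = g (mate (fst R) h)"
      "\<And>h. h \<in> halves (fst R) \<Longrightarrow> rot (fst S) (g h) = g (rot (fst R) h)"
    and root: "h0 \<in> halves (fst R)" "snd R = Between h0 (rot (fst R) h0)"
      "snd S = Between (g h0) (rot (fst S) (g h0))"
  shows "\<exists>f. is_rooted_iso f g R S"
proof -
  let ?M = "fst R" and ?N = "fst S"
  have M: "is_map ?M" and N: "is_map ?N" using R S by (auto simp: is_rooted_map_def)
  have gN: "g h \<in> halves ?N" if "h \<in> halves ?M" for h using g that by (auto simp: bij_betw_def)
  have pow: "(rot ?N ^^ k) (g h) = g ((rot ?M ^^ k) h)" if "h \<in> halves ?M" for h k
    by (induction k) (simp_all add: comm(2) funpow_rot_halves[OF M that])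
  have inj: "inj_on g (halves ?M)" using g by (simp add: bij_betw_def)
  have same: "base ?N (g h) = base ?N (g k) \<longleftrightarrow> base ?M h = base ?M k"
    if "h \<in> halves ?M" "k \<in> halves ?M" for h k
    using that unfolding cyclic_halves[OF M that] cyclic_halves[OF N gN[OF that(1)] gN[OF that(2)]]
    by (simp add: pow inj_on_eq_iff[OF inj] funpow_rot_halves[OF M])
  define c where "c v = (SOME h. h \<in> halves ?M \<and> base ?M h = v)" for v
  define f where "f v = base ?N (g (c v))" for v
  have c: "c v \<in> halves ?M \<and> base ?M (c v) = v" if "v \<in> verts ?M" for v
  proof -
    have "\<exists>h. h \<in> halves ?M \<and> base ?M h = v"
      using halves_at_nonempty[OF M _ that] root(1) unfolding halves_at_def by blast
    then show ?thesis unfolding c_def by (rule someI_ex)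
  qed
  have fb: "base ?N (g h) = f (base ?M h)" if "h \<in> halves ?M" for h
    unfolding f_def using c[OF map_half_edge_closed(1)[OF M that]] that by (subst same) auto
  have "bij_betw f (verts ?M) (verts ?N)"
  proof (rule bij_betw_imageI)
    show "inj_on f (verts ?M)"
      by (rule inj_onI) (metis c f_def same)
    show "f ` verts ?M = verts ?N"
    proof (intro equalityI subsetI)
      fix w assume "w \<in> f ` verts ?M"
      then show "w \<in> verts ?N" unfolding f_def using c gN map_half_edge_closed(1)[OF N] by auto
    next
      fix w assume "w \<in> verts ?N"
      then obtain k where k: "k \<in> halves ?N" "base ?N k = w"
        using halves_at_nonempty[OF N, of w] gN[OF root(1)] by (auto simp: halves_at_def)
      then obtain h where "h \<in> halves ?M" "k = g h" using g by (auto simp: bij_betw_def)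
      then show "w \<in> f ` verts ?M" using k fb map_half_edge_closed(1)[OF M] by auto
    qed
  qed
  then have "is_rooted_iso f g R S"
    unfolding is_rooted_iso_def Let_def using g fb comm root by auto
  then show ?thesis by (rule exI[of "\<lambda>f. is_rooted_iso f g R S"])
qed

lemma root_of_halves:
  assumes "is_rooted_map R" "halves (fst R) \<noteq> {}"
  obtains h where "h \<in> halves (fst R)" "snd R = Between h (rot (fst R) h)"
  using assms(1)
proof (cases rule: corner_cases)
  case (lone v)
  have "Lone v \<in> corners (fst R)" using assms(1) lone by (simp add: is_rooted_map_def)
  then have "halves_at (fst R) v = {}" by (auto simp: corners_def)
  then show ?thesis
    using halves_at_nonempty[OF _ assms(2) lone(2)] assms(1) by (simp add: is_rooted_map_def)
qed (use that in blast)

lemma card_root_edges: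
  assumes R: "is_rooted_map R" and root: "h0 \<in> halves (fst R)" "snd R = Between h0 (rot (fst R) h0)"
  shows "card (root_edges R) = card (edges (fst R)) - card (avoiding (edges (fst R)) h0 (rot (fst R)))"
proof -
  let ?M = "fst R"
  have M: "is_map ?M" using R by (simp add: is_rooted_map_def)
  interpret pairing "halves ?M" "edges ?M" "card (edges ?M)"
    using M pairing_edges by (auto simp: is_map_def)
  have "base ?M h = base ?M h0 \<longleftrightarrow> h \<in> cycle_of (rot ?M) h0" if "h \<in> halves ?M" for h
    using cyclic_halves[OF M root(1) that] by (auto simp: cycle_of_def)
  then have "root_edges R = edges ?M - avoiding (edges ?M) h0 (rot ?M)"
    using Union_E unfolding root_edges_def avoiding_def root(2) by auto
  then show ?thesis
    using finite_E by (simp add: card_Diff_subset avoiding_def)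
qed

section \<open>From two permutations to a map\<close>

definition involutions :: "'a set \<Rightarrow> ('a \<Rightarrow> 'a) set" where
  "involutions H = {a. a permutes H \<and> (\<forall>h\<in>H. a h \<noteq> h \<and> a (a h) = h)}"

definition orbits_of :: "('a \<Rightarrow> 'a) \<Rightarrow> 'a set \<Rightarrow> 'a set set" where
  "orbits_of a H = {{h, a h} |h. h \<in> H}"

text \<open>Vertices have to be natural numbers, so a cycle of \<open>s\<close> is named by its
  least element.\<close>

definition perm_map :: "nat set \<Rightarrow> (nat \<Rightarrow> nat) \<Rightarrow> (nat \<Rightarrow> nat) \<Rightarrow> (nat, nat) premap" where
  "perm_map H s a = \<lparr>verts = (\<lambda>h. LEAST x. x \<in> cycle_of s h) ` H, halves = H,
     base = (\<lambda>h. LEAST x. x \<in> cycle_of s h), mate = a, rot = s\<rparr>"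

lemma perm_map_simps [simp]:
  "halves (perm_map H s a) = H" "mate (perm_map H s a) = a" "rot (perm_map H s a) = s"
  "verts (perm_map H s a) = base (perm_map H s a) ` H"
  "edges (perm_map H s a) = orbits_of a H"
  by (simp_all add: perm_map_def edges_def orbits_of_def)

lemma base_perm_map_eq_iff:
  assumes s: "s permutes H" "finite H" and h: "h \<in> H" "h' \<in> H"
  shows "base (perm_map H s a) h = base (perm_map H s a) h' \<longleftrightarrow> h' \<in> cycle_of s h"
proof
  have L: "base (perm_map H s a) k \<in> cycle_of s k" for k
    unfolding perm_map_def by (simp, rule LeastI, rule self_in_cycle_of)
  assume "base (perm_map H s a) h = base (perm_map H s a) h'"
  then have "cycle_of s h = cycle_of s h'"
    using cycle_of_eq[OF s h(1) L] cycle_of_eq[OF s h(2) L] by metis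
  then show "h' \<in> cycle_of s h" by (simp add: self_in_cycle_of)
next
  assume "h' \<in> cycle_of s h"
  then show "base (perm_map H s a) h = base (perm_map H s a) h'"
    using cycle_of_eq[OF s h(1)] by (simp add: perm_map_def)
qed

lemma is_multigraph_perm_map:
  assumes "finite H" "a \<in> involutions H"
  shows "is_multigraph (perm_map H s a)"
  unfolding is_multigraph_def perm_map_simps
proof (intro conjI ballI)
  fix h assume h: "h \<in> H"
  show "base (perm_map H s a) h \<in> base (perm_map H s a) ` H" using h by (rule imageI)
  show "a h \<in> H" "a h \<noteq> h" "a (a h) = h"
    using assms(2) h by (auto simp: involutions_def permutes_in_image)
qed (use assms(1) in auto)

lemma pairing_orbits_of:
  fixes H :: "nat set"
  assumes "finite H" "a \<in> involutions H" "card H = 2 * n"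
  shows "pairing H (orbits_of a H) n"
proof -
  interpret pairing H "orbits_of a H" "card (orbits_of a H)"
    using pairing_edges[OF is_multigraph_perm_map[OF assms(1,2)]] unfolding perm_map_simps .
  have "2 * card (orbits_of a H) = 2 * n" using card_S assms(3) by (simp only:)
  then have "card (orbits_of a H) = n" by simp
  then show ?thesis using pairing_axioms by (simp only:)
qed

text \<open>Transitivity in terms of half-edges. The orbits contained in C cover C because C is
  closed under \<open>a\<close>, so indecomposability applies to them.\<close>

lemma indecomposable_closed:
  fixes H :: "nat set"
  assumes "finite H" "a \<in> involutions H" "indecomposable (orbits_of a H) s"
    and C: "C \<subseteq> H" "C \<noteq> {}" "\<And>h. h \<in> C \<Longrightarrow> s h \<in> C" "\<And>h. h \<in> C \<Longrightarrow> a h \<in> C"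
  shows "C = H"
proof -
  interpret pairing H "orbits_of a H" "card (orbits_of a H)"
    using pairing_edges[OF is_multigraph_perm_map[OF assms(1,2)]] unfolding perm_map_simps .
  define F where "F = {e \<in> orbits_of a H. e \<subseteq> C}"
  have "{h, a h} \<in> F" if "h \<in> C" for h
    using that C unfolding F_def orbits_of_def by blast
  then have UF: "\<Union>F = C" unfolding F_def by blast
  then have "F \<noteq> {}" "F \<subseteq> orbits_of a H" "s ` \<Union>F \<subseteq> \<Union>F" using C by (auto simp: F_def)
  then have "F = orbits_of a H"
    using assms(3) unfolding indecomposable_def by blast
  then show ?thesis using UF Union_E by simp
qed

text \<open>For connectivity, the half-edges whose vertex is reachable from that of a given one are
  closed under \<open>a\<close>, which follows an edge, and under \<open>s\<close>, which stays at
  the vertex. By transitivity they are all of H.\<close>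

lemma is_map_perm_map:
  assumes s: "s permutes H" "finite H" and a: "a \<in> involutions H" and "H \<noteq> {}"
    and ind: "indecomposable (orbits_of a H) s"
  shows "is_map (perm_map H s a)"
  unfolding is_map_def
proof (intro conjI ballI)
  let ?M = "perm_map H s a"
  show "is_multigraph ?M" by (rule is_multigraph_perm_map[OF s(2) a])
  have aH: "a h \<in> H" "a (a h) = h" if "h \<in> H" for h
    using a that by (auto simp: involutions_def permutes_in_image)
  have sH: "s h \<in> H" if "h \<in> H" for h using that s(1) by (simp add: permutes_in_image)
  have base_s: "base ?M (s h) = base ?M h" if "h \<in> H" for h
  proof -
    have "s h \<in> cycle_of s h" using self_in_cycle_of cycle_of_closed by fast
    then show ?thesis using base_perm_map_eq_iff[OF s that sH[OF that]] by simp
  qed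
  have reach: "(base ?M h0, base ?M h) \<in> (adjacency ?M)\<^sup>*" if "h0 \<in> H" "h \<in> H" for h0 h
  proof -
    define C where "C = {h \<in> H. (base ?M h0, base ?M h) \<in> (adjacency ?M)\<^sup>*}"
    have "(base ?M h, base ?M (a h)) \<in> adjacency ?M" if "h \<in> H" for h
      unfolding adjacency_def perm_map_simps using that by blast
    then have "a h \<in> C" if "h \<in> C" for h
      using that aH(1) unfolding C_def by (blast intro: rtrancl_into_rtrancl)
    moreover have "s h \<in> C" if "h \<in> C" for h using that by (simp add: C_def sH base_s)
    moreover have "h0 \<in> C" "C \<subseteq> H" using that(1) by (auto simp: C_def)
    ultimately have "C = H" using indecomposable_closed[OF s(2) a ind, of C] by blast
    then show ?thesis using that(2) by (auto simp: C_def)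
  qed
  show "is_connected ?M" using reach \<open>H \<noteq> {}\<close> by (auto simp: is_connected_def)
  fix v assume "v \<in> verts ?M"
  then obtain h0 where h0: "h0 \<in> H" "v = base ?M h0" by auto
  have at: "halves_at ?M v = cycle_of s h0"
  proof -
    have "cycle_of s h0 \<subseteq> H" using cycle_of_least[OF h0(1)] sH by blast
    moreover have "base ?M h = base ?M h0 \<longleftrightarrow> h \<in> cycle_of s h0" if "h \<in> H" for h
      using base_perm_map_eq_iff[OF s h0(1) that] by metis
    ultimately show ?thesis unfolding halves_at_def h0(2) by auto
  qed
  have fin: "finite (cycle_of s h0)"
    using cycle_of_least[OF h0(1), of s] sH s(2) finite_subset by blast
  have "s ` cycle_of s h0 = cycle_of s h0"
    using permutes_inj[OF s(1)] fin cycle_of_closed by (metis endo_inj_surj inj_on_subset subset_UNIV)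
  moreover have "\<exists>k. (s ^^ k) h = h'" if "h \<in> cycle_of s h0" "h' \<in> cycle_of s h0" for h h'
  proof -
    have "h' \<in> cycle_of s h" using that(2) cycle_of_eq[OF s h0(1) that(1)] by simp
    then show ?thesis by (auto simp: cycle_of_def)
  qed
  ultimately show "cyclic_on (rot ?M) (halves_at ?M v)"
    using permutes_inj[OF s(1)] by (auto simp: cyclic_on_def at bij_betw_def intro: inj_on_subset)
qed

definition perm_rooted_map :: "nat set \<Rightarrow> (nat \<Rightarrow> nat) \<times> (nat \<Rightarrow> nat) \<Rightarrow> (nat, nat) rooted_premap" where
  "perm_rooted_map H = (\<lambda>(s, a). (perm_map H s a, Between 0 (s 0)))"

definition map_perms :: "nat set \<Rightarrow> ((nat \<Rightarrow> nat) \<times> (nat \<Rightarrow> nat)) set" where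
  "map_perms H = {(s, a). s permutes H \<and> a \<in> involutions H \<and> indecomposable (orbits_of a H) s}"

lemma is_rooted_map_perm:
  assumes "finite H" "0 \<in> H" "p \<in> map_perms H"
  shows "is_rooted_map (perm_rooted_map H p)"
proof -
  obtain s a where p: "p = (s, a)" "s permutes H" "a \<in> involutions H" "indecomposable (orbits_of a H) s"
    using assms(3) by (auto simp: map_perms_def)
  then have "is_map (perm_map H s a)" using is_map_perm_map assms by blast
  moreover have "Between 0 (s 0) \<in> corners (perm_map H s a)"
    unfolding corners_def perm_map_simps using assms(2) by blast
  ultimately show ?thesis by (simp add: is_rooted_map_def perm_rooted_map_def p(1))
qed

text \<open>The fixed points of an automorphism are closed under both permutations.\<close>

lemma map_perms_rigid:
  assumes "finite H" "0 \<in> H" "(s, a) \<in> map_perms H"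
    and g: "g permutes H" "g 0 = 0" "g \<circ> s = s \<circ> g" "g \<circ> a = a \<circ> g"
  shows "g = id"
proof -
  have a: "a \<in> involutions H" and s: "s permutes H" and ind: "indecomposable (orbits_of a H) s"
    using assms(3) by (auto simp: map_perms_def)
  define C where "C = {h \<in> H. g h = h}"
  have "s h \<in> C" if "h \<in> C" for h
    using that fun_cong[OF g(3), of h] s by (simp add: C_def permutes_in_image)
  moreover have "a h \<in> C" if "h \<in> C" for h
    using that fun_cong[OF g(4), of h] a by (simp add: C_def permutes_in_image involutions_def)
  moreover have "0 \<in> C" "C \<subseteq> H" using assms(2) g(2) by (auto simp: C_def)
  ultimately have "C = H" using indecomposable_closed[OF assms(1) a ind, of C] by blast
  then have "g h = h" for h using permutes_not_in[OF g(1), of h] by (cases "h \<in> H") (auto simp: C_def)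
  then show ?thesis by auto
qed

section \<open>Relabellings\<close>

definition perm_class :: "nat \<Rightarrow> (nat \<Rightarrow> nat) \<times> (nat \<Rightarrow> nat) \<Rightarrow> (nat, nat) rooted_premap set" where
  "perm_class n p = rooted_iso_rel n `` {perm_rooted_map {..<2 * n} p}"

lemma perm_rooted_map_labelled:
  assumes "n > 0" "p \<in> map_perms {..<2 * n}"
  shows "perm_rooted_map {..<2 * n} p \<in> labelled_rooted_maps n"
proof -
  obtain s a where p: "p = (s, a)" "a \<in> involutions {..<2 * n}" using assms(2) by (auto simp: map_perms_def)
  interpret pairing "{..<2 * n}" "orbits_of a {..<2 * n}" n
    using p(2) by (intro pairing_orbits_of) auto
  show ?thesis
    using is_rooted_map_perm[OF _ _ assms(2)] assms(1) card_E
    by (simp add: labelled_rooted_maps_def perm_rooted_map_def p(1))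
qed

lemma perm_class_eq_iff:
  assumes "n > 0" "p \<in> map_perms {..<2 * n}" "q \<in> map_perms {..<2 * n}"
  shows "perm_class n p = perm_class n q \<longleftrightarrow>
    (\<exists>f g. is_rooted_iso f g (perm_rooted_map {..<2 * n} p) (perm_rooted_map {..<2 * n} q))"
  using eq_equiv_class_iff[OF equiv_rooted_iso_rel perm_rooted_map_labelled[OF assms(1,2)]
      perm_rooted_map_labelled[OF assms(1,3)]]
    perm_rooted_map_labelled[OF assms(1,2)] perm_rooted_map_labelled[OF assms(1,3)]
  by (simp add: perm_class_def rooted_iso_rel_def)

lemma perm_class_in:
  assumes "n > 0" "p \<in> map_perms {..<2 * n}"
  shows "perm_class n p \<in> rooted_maps n" "perm_rooted_map {..<2 * n} p \<in> perm_class n p"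
  using perm_rooted_map_labelled[OF assms] equiv_class_self[OF equiv_rooted_iso_rel]
  by (auto simp: perm_class_def rooted_maps_def intro: quotientI)

lemma root_edge_count_perm_class:
  assumes n: "n > 0" and p: "(s, a) \<in> map_perms {..<2 * n}"
  shows "root_edge_count (perm_class n (s, a)) = n - card (avoiding (orbits_of a {..<2 * n}) 0 s)"
proof -
  interpret pairing "{..<2 * n}" "orbits_of a {..<2 * n}" n
    using p by (intro pairing_orbits_of) (auto simp: map_perms_def)
  have "root_edge_count (perm_class n (s, a)) = card (root_edges (perm_rooted_map {..<2 * n} (s, a)))"
    using root_edge_count_class perm_class_in[OF n p] by blast
  also have "\<dots> = n - card (avoiding (orbits_of a {..<2 * n}) 0 s)"
    using card_root_edges[of "perm_rooted_map {..<2 * n} (s, a)" 0] is_rooted_map_perm[OF _ _ p] n card_E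
    by (simp add: perm_rooted_map_def)
  finally show ?thesis .
qed

section \<open>Relabelling as simultaneous conjugation\<close>

definition conj_by :: "('a \<Rightarrow> 'a) \<Rightarrow> ('a \<Rightarrow> 'a) \<Rightarrow> 'a \<Rightarrow> 'a" where
  "conj_by g s = g \<circ> s \<circ> inv g"

lemma conj_by_permutes: "g permutes H \<Longrightarrow> s permutes H \<Longrightarrow> conj_by g s permutes H"
  by (simp add: conj_by_def permutes_compose permutes_inv)

lemma conj_by_apply: "g permutes H \<Longrightarrow> conj_by g s (g h) = g (s h)"
  by (simp add: conj_by_def permutes_inverses)

lemma conj_by_eqI:
  assumes "g permutes H" "t permutes H" "s permutes H" "\<And>h. h \<in> H \<Longrightarrow> t (g h) = g (s h)"
  shows "t = conj_by g s"
proof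
  fix x
  show "t x = conj_by g s x"
  proof (cases "x \<in> H")
    case True
    then have "inv g x \<in> H" using permutes_inv[OF assms(1)] by (simp add: permutes_in_image)
    then have "t (g (inv g x)) = g (s (inv g x))" by (rule assms(4))
    then show ?thesis by (simp add: conj_by_def permutes_inverses[OF assms(1)])
  next
    case False
    then show ?thesis
      using permutes_not_in[OF assms(2)] permutes_not_in[OF conj_by_permutes[OF assms(1,3)]] by simp
  qed
qed

text \<open>Transitivity is checked by pulling back along \<open>g\<close>: the preimage of a closed
  union of orbits is closed under \<open>s\<close> and \<open>a\<close>, hence is all of H.\<close>

lemma conj_by_map_perms:
  fixes H :: "nat set"
  assumes "finite H" "g permutes H" "(s, a) \<in> map_perms H"
  shows "(conj_by g s, conj_by g a) \<in> map_perms H"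
proof -
  have s: "s permutes H" and a: "a \<in> involutions H" and ind: "indecomposable (orbits_of a H) s"
    using assms(3) by (auto simp: map_perms_def)
  have aH: "a permutes H" "\<And>h. h \<in> H \<Longrightarrow> a h \<in> H \<and> a h \<noteq> h \<and> a (a h) = h"
    using a by (auto simp: involutions_def permutes_in_image)
  note ap = conj_by_apply[OF assms(2)]
  have gH: "\<exists>h\<in>H. x = g h" if "x \<in> H" for x
    using that permutes_image[OF assms(2)] by blast
  have inj: "inj g" using assms(2) by (rule permutes_inj)
  have ca: "conj_by g a \<in> involutions H"
    unfolding involutions_def
  proof (intro CollectI conjI ballI)
    show "conj_by g a permutes H" by (rule conj_by_permutes[OF assms(2) aH(1)])
    fix x assume "x \<in> H"
    then obtain h where h: "h \<in> H" "x = g h" using gH by blast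
    show "conj_by g a x \<noteq> x" "conj_by g a (conj_by g a x) = x"
      using aH(2)[OF h(1)] unfolding h(2) by (simp_all add: ap inj_eq[OF inj])
  qed
  have "indecomposable (orbits_of (conj_by g a) H) (conj_by g s)"
    unfolding indecomposable_def
  proof (intro allI impI)
    fix F assume F: "F \<subseteq> orbits_of (conj_by g a) H" "F \<noteq> {}" "conj_by g s ` \<Union>F \<subseteq> \<Union>F"
    interpret pairing H "orbits_of (conj_by g a) H" "card (orbits_of (conj_by g a) H)"
      using pairing_edges[OF is_multigraph_perm_map[OF assms(1) ca]] unfolding perm_map_simps .
    let ?C = "{h \<in> H. g h \<in> \<Union>F}"
    have closed: "conj_by g a x \<in> \<Union>F" if "x \<in> \<Union>F" for x
    proof -
      obtain e where e: "e \<in> F" "x \<in> e" using \<open>x \<in> \<Union>F\<close> by blast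
      then obtain k where "k \<in> H" "e = {k, conj_by g a k}" using F(1) unfolding orbits_of_def by blast
      then have "conj_by g a x \<in> e" using e(2) ca by (auto simp: involutions_def)
      then show ?thesis using e(1) by blast
    qed
    obtain e where "e \<in> F" using F(2) by blast
    moreover from this obtain x where "x \<in> e" using F(1) unfolding orbits_of_def by blast
    ultimately have "x \<in> H" "x \<in> \<Union>F" using F(1) Union_E by auto
    then have "?C \<noteq> {}" using gH by blast
    moreover have "s h \<in> ?C" if "h \<in> ?C" for h
    proof -
      have "conj_by g s (g h) \<in> \<Union>F" using that F(3) by blast
      then show ?thesis using that s by (simp only: ap mem_Collect_eq permutes_in_image simp_thms)
    qed
    moreover have "a h \<in> ?C" if "h \<in> ?C" for h
      using that closed[of "g h"] aH ap[of a h] by auto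
    ultimately have "?C = H" using indecomposable_closed[OF assms(1) a ind, of ?C] by blast
    then have "\<Union>F = H" using gH F(1) Union_E by blast
    then have "card F = card (orbits_of (conj_by g a) H)"
      using card_Union_pairs(2)[OF F(1)] card_S by simp
    then show "F = orbits_of (conj_by g a) H" using F(1) finite_E by (simp add: card_subset_eq)
  qed
  then show ?thesis using ca conj_by_permutes[OF assms(2) s] by (simp add: map_perms_def)
qed

text \<open>An isomorphism preserves the root corner, which starts at half-edge 0 on both sides. So
  it is a relabelling that fixes 0, and it acts on both permutations by conjugation.\<close>

lemma perm_class_fibre:
  assumes n: "n > 0" and p: "(s, a) \<in> map_perms {..<2 * n}"
  shows "{q \<in> map_perms {..<2 * n}. perm_class n q = perm_class n (s, a)}
    = (\<lambda>g. (conj_by g s, conj_by g a)) ` {g. g permutes {1..<2 * n}}" (is "?L = ?R")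
proof (intro equalityI subsetI)
  let ?H = "{..<2 * n}"
  have s: "s permutes ?H" and a: "a permutes ?H"
    using p by (auto simp: map_perms_def involutions_def)
  {
    fix q assume "q \<in> ?L"
    then obtain t b where q: "q = (t, b)" "(t, b) \<in> map_perms ?H" "perm_class n (s, a) = perm_class n (t, b)"
      by (cases q) auto
    have t: "t permutes ?H" and b: "b permutes ?H"
      using q(2) by (auto simp: map_perms_def involutions_def)
    obtain f g where iso: "is_rooted_iso f g (perm_rooted_map ?H (s, a)) (perm_rooted_map ?H (t, b))"
      using perm_class_eq_iff[OF n p q(2)] q(3) by blast
    then have g: "bij_betw g ?H ?H" "g 0 = 0" "\<And>h. h \<in> ?H \<Longrightarrow> b (g h) = g (a h)"
      "\<And>h. h \<in> ?H \<Longrightarrow> t (g h) = g (s h)"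
      by (auto simp: is_rooted_iso_def Let_def perm_rooted_map_def)
    \<comment> \<open>Outside the half-edges the values of \<open>g\<close> are arbitrary; resetting
      them to the identity gives a genuine permutation.\<close>
    define g' where "g' x = (if x \<in> ?H then g x else x)" for x
    have "bij_betw g' ?H ?H \<longleftrightarrow> bij_betw g ?H ?H"
      by (rule bij_betw_cong) (simp add: g'_def)
    then have "bij_betw g' ?H ?H" using g(1) by simp
    then have g': "g' permutes ?H" by (rule bij_imp_permutes) (simp add: g'_def)
    have "g' permutes {1..<2 * n}"
      by (rule permutes_superset[OF g']) (use g(2) in \<open>auto simp: g'_def Suc_le_eq\<close>)
    moreover have "s h \<in> ?H" "a h \<in> ?H" if "h \<in> ?H" for h
      using that s a by (simp_all only: permutes_in_image)
    then have "t = conj_by g' s" "b = conj_by g' a"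
      using g by (auto intro!: conj_by_eqI[OF g'] s t a b simp: g'_def)
    ultimately show "q \<in> ?R" unfolding q(1) by blast
  next
    fix q assume "q \<in> ?R"
    then obtain g where g: "g permutes {1..<2 * n}" and q: "q = (conj_by g s, conj_by g a)" by blast
    have gH: "g permutes ?H" using g by (rule permutes_subset) auto
    have g0: "g 0 = 0" using g by (rule permutes_not_in) simp
    have qT: "q \<in> map_perms ?H" unfolding q by (rule conj_by_map_perms[OF _ gH p]) simp
    have "\<exists>f. is_rooted_iso f g (perm_rooted_map ?H (s, a)) (perm_rooted_map ?H q)"
      using is_rooted_map_perm[OF _ _ p] is_rooted_map_perm[OF _ _ qT] n g0
        conj_by_apply[OF gH] permutes_imp_bij[OF gH]
      by (intro rooted_iso_of_halves[where ?h0.0 = 0]) (auto simp: perm_rooted_map_def q)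
    then have "perm_class n (s, a) = perm_class n q" using perm_class_eq_iff[OF n p qT] by blast
    then show "q \<in> ?L" using qT by simp
  }
qed

text \<open>If \<open>g\<close> and \<open>k\<close> give the same conjugates, then
  \<open>inv k \<circ> g\<close> commutes with both permutations and fixes 0, so it is the identity
  by \<open>map_perms_rigid\<close>. The fibre is therefore as large as the group permuting the 2n -
  1 nonzero labels.\<close>

lemma card_perm_class_fibre:
  assumes n: "n > 0" and p: "p \<in> map_perms {..<2 * n}"
  shows "card {q \<in> map_perms {..<2 * n}. perm_class n q = perm_class n p} = fact (2 * n - 1)"
proof -
  obtain s a where sa: "p = (s, a)" by (cases p)
  note p = p[unfolded sa]
  have "inj_on (\<lambda>g. (conj_by g s, conj_by g a)) {g. g permutes {1..<2 * n}}"
  proof (rule inj_onI, clarify)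
    fix g k assume g: "g permutes {1..<2 * n}" and k: "k permutes {1..<2 * n}"
      and eq: "conj_by g s = conj_by k s" "conj_by g a = conj_by k a"
    let ?r = "inv k \<circ> g"
    have comm: "?r \<circ> x = x \<circ> ?r" if "conj_by g x = conj_by k x" for x
    proof
      fix h
      have "conj_by k x (g h) = k (x (inv k (g h)))"
        using conj_by_apply[OF k, of x "inv k (g h)"] by (simp add: permutes_inverses[OF k])
      then have "g (x h) = k (x (inv k (g h)))"
        using that conj_by_apply[OF g, of x h] by simp
      then show "(?r \<circ> x) h = (x \<circ> ?r) h"
        by (simp add: permutes_inverses[OF k])
    qed
    have r: "?r permutes {1..<2 * n}" using g k by (simp add: permutes_compose permutes_inv)
    have "?r = id"
    proof (rule map_perms_rigid[OF _ _ p _ _ comm[OF eq(1)] comm[OF eq(2)]])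
      show "?r permutes {..<2 * n}" using r by (rule permutes_subset) auto
      show "?r 0 = 0" using r by (rule permutes_not_in) simp
    qed (use n in auto)
    then have "inv k (g h) = h" for h by (metis comp_apply id_apply)
    then have "g h = k h" for h using permutes_inverses[OF k] by metis
    then show "g = k" by blast
  qed
  then show ?thesis
    unfolding sa perm_class_fibre[OF n p] by (simp add: card_image card_permutations)
qed

text \<open>Number the half-edges of a map so that the root half-edge receives 0, and transport
  rotation and mate along this numbering.\<close>

lemma perm_class_surj:
  assumes n: "n > 0"
  shows "perm_class n ` map_perms {..<2 * n} = rooted_maps n"
proof (intro equalityI subsetI)
  let ?H = "{..<2 * n}"
  fix C assume "C \<in> rooted_maps n"
  then obtain R where R: "R \<in> labelled_rooted_maps n" "C = rooted_iso_rel n `` {R}"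
    unfolding rooted_maps_def by (rule quotientE)
  let ?M = "fst R"
  have RM: "is_rooted_map R" and M: "is_map ?M" and cE: "card (edges ?M) = n"
    using R(1) by (auto simp: labelled_rooted_maps_def is_rooted_map_def)
  interpret pairing "halves ?M" "edges ?M" n
    using M pairing_edges[of ?M] cE by (auto simp: is_map_def)
  have "halves ?M \<noteq> {}" using card_S n by auto
  then obtain h0 where h0: "h0 \<in> halves ?M" "snd R = Between h0 (rot ?M h0)"
    using root_of_halves[OF RM] by metis
  have "card (halves ?M - {h0}) = card {1..<2 * n}" using h0(1) card_S finite_S by simp
  then obtain k where k: "bij_betw k (halves ?M - {h0}) {1..<2 * n}"
    using finite_same_card_bij[of "halves ?M - {h0}" "{1..<2 * n}"] finite_S by auto
  define g where "g h = (if h = h0 then 0 else k h)" for h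
  have "bij_betw g (halves ?M - {h0}) {1..<2 * n} \<longleftrightarrow> bij_betw k (halves ?M - {h0}) {1..<2 * n}"
    by (rule bij_betw_cong) (simp add: g_def)
  then have "bij_betw g (halves ?M - {h0}) {1..<2 * n}" using k by simp
  then have "bij_betw g (insert h0 (halves ?M - {h0})) (insert (g h0) {1..<2 * n})"
    by (subst notIn_Un_bij_betw3[of h0 _ g, simplified, symmetric]) (auto simp: g_def)
  moreover have "insert h0 (halves ?M - {h0}) = halves ?M" "insert (g h0) {1..<2 * n} = ?H"
    using h0(1) n by (auto simp: g_def)
  ultimately have g: "bij_betw g (halves ?M) ?H" by simp
  define g' where "g' = inv_into (halves ?M) g"
  have g': "bij_betw g' ?H (halves ?M)" unfolding g'_def using g by (rule bij_betw_inv_into)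
  have g'g: "g' (g h) = h" if "h \<in> halves ?M" for h
    unfolding g'_def using g that by (rule bij_betw_inv_into_left)
  have gH: "g h \<in> ?H" if "h \<in> halves ?M" for h using g that by (auto simp: bij_betw_def)
  have Hg: "\<exists>h\<in>halves ?M. x = g h" if "x \<in> ?H" for x using g that by (auto simp: bij_betw_def)
  \<comment> \<open>Transport along the numbering, extended by the identity outside the label set so
    that it yields a permutation.\<close>
  define tr where "tr r x = (if x \<in> ?H then g (r (g' x)) else x)" for r x
  have tr: "tr r (g h) = g (r h)" if "h \<in> halves ?M" for r h
    using that gH g'g by (simp add: tr_def)
  have permutes: "tr r permutes ?H" if "bij_betw r (halves ?M) (halves ?M)" for r
  proof (rule bij_imp_permutes)
    have "bij_betw (g \<circ> (r \<circ> g')) ?H ?H" using bij_betw_trans g g' that by blast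
    moreover have "bij_betw (tr r) ?H ?H \<longleftrightarrow> bij_betw (g \<circ> (r \<circ> g')) ?H ?H"
      by (rule bij_betw_cong) (simp add: tr_def)
    ultimately show "bij_betw (tr r) ?H ?H" by simp
  qed (simp add: tr_def)
  have Mh: "\<And>h. h \<in> halves ?M \<Longrightarrow> mate ?M h \<in> halves ?M \<and> mate ?M h \<noteq> h \<and> mate ?M (mate ?M h) = h"
    using M by (simp add: is_map_def is_multigraph_def)
  have "bij_betw (mate ?M) (halves ?M) (halves ?M)"
    by (rule bij_betw_byWitness[where f' = "mate ?M"]) (use Mh in auto)
  then have mate: "tr (mate ?M) permutes ?H" by (rule permutes)
  \<comment> \<open>Injectivity is given at each vertex separately. Since the rotation preserves
    \<open>base\<close>, half-edges with equal images share a vertex.\<close>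
  have "inj_on (rot ?M) (halves ?M)"
  proof (rule inj_onI)
    fix h k assume hk: "h \<in> halves ?M" "k \<in> halves ?M" "rot ?M h = rot ?M k"
    have "base ?M h = base ?M k" using map_rot_base[OF M hk(1)] map_rot_base[OF M hk(2)] hk(3) by simp
    moreover have "inj_on (rot ?M) (halves_at ?M (base ?M h))"
      using M map_half_edge_closed(1)[OF M hk(1)] by (simp add: is_map_def cyclic_on_def bij_betw_def)
    ultimately show "h = k" using hk by (auto simp: halves_at_def dest: inj_onD)
  qed
  then have "bij_betw (rot ?M) (halves ?M) (halves ?M)"
    using map_half_edge_closed(3)[OF M] finite_S by (simp add: bij_betw_def endo_inj_surj image_subsetI)
  then have rot: "tr (rot ?M) permutes ?H" by (rule permutes)
  have inv: "tr (mate ?M) \<in> involutions ?H"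
    unfolding involutions_def
  proof (intro CollectI conjI ballI mate)
    fix x assume "x \<in> ?H"
    then obtain h where h: "h \<in> halves ?M" "x = g h" using Hg by blast
    have "inj_on g (halves ?M)" using g by (simp add: bij_betw_def)
    then show "tr (mate ?M) x \<noteq> x" "tr (mate ?M) (tr (mate ?M) x) = x"
      unfolding h(2) using Mh[OF h(1)] h(1) by (simp_all add: tr inj_on_eq_iff)
  qed
  interpret P: pairing ?H "orbits_of (tr (mate ?M)) ?H" n
    using inv by (intro pairing_orbits_of) auto
  have img: "orbits_of (tr (mate ?M)) ?H = (`) g ` edges ?M"
  proof -
    have "orbits_of (tr (mate ?M)) ?H = (\<lambda>x. {x, tr (mate ?M) x}) ` g ` halves ?M"
      using g by (auto simp: orbits_of_def bij_betw_def)
    also have "\<dots> = (\<lambda>h. g ` {h, mate ?M h}) ` halves ?M"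
      unfolding image_image by (rule image_cong) (simp_all add: tr)
    also have "\<dots> = (`) g ` (\<lambda>h. {h, mate ?M h}) ` halves ?M" by (simp only: image_image)
    also have "(\<lambda>h. {h, mate ?M h}) ` halves ?M = edges ?M" by (auto simp: edges_def)
    finally show ?thesis .
  qed
  have "indecomposable (orbits_of (tr (mate ?M)) ?H) (tr (rot ?M))"
    unfolding indecomposable_def
  proof (intro allI impI)
    fix F assume F: "F \<subseteq> orbits_of (tr (mate ?M)) ?H" "F \<noteq> {}" "tr (rot ?M) ` \<Union>F \<subseteq> \<Union>F"
    then obtain F' where F': "F' \<subseteq> edges ?M" "F = (`) g ` F'"
      unfolding img by (meson subset_imageE)
    have U: "\<Union>F = g ` \<Union>F'" unfolding F'(2) by blast
    have sub: "\<Union>F' \<subseteq> halves ?M" using F'(1) Union_E by blast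
    have "rot ?M ` \<Union>F' \<subseteq> \<Union>F'"
    proof (rule image_subsetI)
      fix h assume h: "h \<in> \<Union>F'"
      then have hM: "h \<in> halves ?M" using sub by blast
      then have "g (rot ?M h) \<in> g ` \<Union>F'" using F(3) h tr[OF hM, of "rot ?M"] unfolding U by (metis image_eqI subsetD)
      moreover have "inj_on g (halves ?M)" using g by (simp add: bij_betw_def)
      ultimately show "rot ?M h \<in> \<Union>F'"
        using inj_on_image_mem_iff[OF _ map_half_edge_closed(3)[OF M hM] sub] by metis
    qed
    then have "F' = edges ?M"
      using map_indecomposable[OF M] F'(1) F(2) F'(2) unfolding indecomposable_def by blast
    then show "F = orbits_of (tr (mate ?M)) ?H" unfolding img F'(2) by simp
  qed
  then have p: "(tr (rot ?M), tr (mate ?M)) \<in> map_perms ?H"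
    using inv rot by (simp add: map_perms_def)
  have "\<exists>f. is_rooted_iso f g R (perm_rooted_map ?H (tr (rot ?M), tr (mate ?M)))"
    using is_rooted_map_perm[OF _ _ p] n g h0 tr RM
    by (intro rooted_iso_of_halves[where ?h0.0 = h0]) (auto simp: perm_rooted_map_def g_def)
  then have "(R, perm_rooted_map ?H (tr (rot ?M), tr (mate ?M))) \<in> rooted_iso_rel n"
    using R(1) perm_rooted_map_labelled[OF n p] by (auto simp: rooted_iso_rel_def)
  then have "C = perm_class n (tr (rot ?M), tr (mate ?M))"
    unfolding R(2) perm_class_def by (rule equiv_class_eq[OF equiv_rooted_iso_rel])
  then show "C \<in> perm_class n ` map_perms ?H" using p by blast
qed (use perm_class_in[OF n] in blast)

text \<open>Equal fibres make a uniform transitive pair induce a uniform rooted map.\<close>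

lemma sum_perm_class:
  fixes f :: "_ \<Rightarrow> real"
  assumes n: "n > 0"
  shows "(\<Sum>p\<in>map_perms {..<2 * n}. f (perm_class n p)) = fact (2 * n - 1) * (\<Sum>C\<in>rooted_maps n. f C)"
    and "finite (map_perms {..<2 * n})" "finite (rooted_maps n)"
proof -
  let ?H = "{..<2 * n}"
  have "map_perms ?H \<subseteq> {s. s permutes ?H} \<times> {a. a permutes ?H}"
    by (auto simp: map_perms_def involutions_def)
  then show fin: "finite (map_perms ?H)"
    by (rule finite_subset) (simp add: finite_permutations)
  then show finR: "finite (rooted_maps n)" unfolding perm_class_surj[OF n, symmetric] by simp
  have "(\<Sum>p\<in>map_perms ?H. f (perm_class n p)) =
      (\<Sum>C\<in>rooted_maps n. \<Sum>p\<in>{p \<in> map_perms ?H. perm_class n p = C}. f (perm_class n p))"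
    using fin finR perm_class_surj[OF n] by (intro sum.group[symmetric]) auto
  also have "\<dots> = (\<Sum>C\<in>rooted_maps n. fact (2 * n - 1) * f C)"
  proof (rule sum.cong[OF refl])
    fix C assume "C \<in> rooted_maps n"
    then obtain q where "q \<in> map_perms ?H" "C = perm_class n q" using perm_class_surj[OF n] by blast
    then have "card {p \<in> map_perms ?H. perm_class n p = C} = fact (2 * n - 1)"
      using card_perm_class_fibre[OF n] by simp
    then show "(\<Sum>p\<in>{p \<in> map_perms ?H. perm_class n p = C}. f (perm_class n p)) = fact (2 * n - 1) * f C"
      by simp
  qed
  finally show "(\<Sum>p\<in>map_perms ?H. f (perm_class n p)) = fact (2 * n - 1) * (\<Sum>C\<in>rooted_maps n. f C)"
    by (simp add: sum_distrib_left)
qed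

section \<open>The limit law\<close>

lemma finite_involutions: "finite H \<Longrightarrow> finite (involutions H)"
  by (rule finite_subset[OF _ finite_permutations[of H]]) (auto simp: involutions_def)

lemma involutions_nonempty: "involutions {..<2 * n :: nat} \<noteq> {}"
proof -
  \<comment> \<open>This involution swaps 2i and 2i + 1.\<close>
  define a where "a x = (if x < 2 * n then if even x then x + 1 else x - 1 else x)" for x
  have a: "a x < 2 * n \<and> a x \<noteq> x \<and> a (a x) = x" if "x < 2 * n" for x
  proof (cases "even x")
    case True
    then have "x + 1 < 2 * n" using that by presburger
    then show ?thesis using True that by (simp add: a_def)
  next
    case False
    then have "even (x - 1)" "x - 1 + 1 = x" "x > 0" by (simp_all add: odd_pos)
    then show ?thesis using False that by (auto simp: a_def)
  qed
  have "a permutes {..<2 * n}"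
  proof (rule bij_imp_permutes)
    show "bij_betw a {..<2 * n} {..<2 * n}"
      by (rule bij_betw_byWitness[where f' = a]) (use a in auto)
  qed (simp add: a_def)
  then have "a \<in> involutions {..<2 * n}" using a by (simp add: involutions_def)
  then show ?thesis by blast
qed

lemma sum_map_perms:
  fixes f :: "_ \<Rightarrow> real"
  assumes "finite H"
  shows "(\<Sum>p\<in>map_perms H. f p) =
    (\<Sum>a\<in>involutions H. \<Sum>s | s permutes H \<and> indecomposable (orbits_of a H) s. f (s, a))"
proof -
  let ?B = "\<lambda>a. {s. s permutes H \<and> indecomposable (orbits_of a H) s}"
  have "map_perms H = (\<lambda>(a, s). (s, a)) ` Sigma (involutions H) ?B"
    by (auto simp: map_perms_def)
  moreover have "inj_on (\<lambda>(a, s). (s, a)) (Sigma (involutions H) ?B)" by (auto simp: inj_on_def)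
  ultimately have "(\<Sum>p\<in>map_perms H. f p) = (\<Sum>(a, s)\<in>Sigma (involutions H) ?B. f (s, a))"
    by (simp add: sum.reindex case_prod_unfold)
  also have "\<dots> = (\<Sum>a\<in>involutions H. \<Sum>s\<in>?B a. f (s, a))"
    using finite_involutions[OF assms] finite_permutations[OF assms]
    by (subst sum.Sigma) auto
  finally show ?thesis .
qed

text \<open>The constant \<open>K\<close> counts all pairs, transitive or not. For each involution,
  \<open>moment_avoiding\<close> treats all rotations; the decomposable ones are then removed, and
  as each summand is at most 1 this adds the 4 to the error constant.\<close>

lemma map_perms_moment:
  fixes n m :: nat
  assumes n: "n \<ge> 2"
  defines "K \<equiv> real (card (involutions {..<2 * n})) * fact (2 * n)"
  shows "\<bar>(\<Sum>(s, a)\<in>map_perms {..<2 * n}. (real (card (avoiding (orbits_of a {..<2 * n}) 0 s)) / n) ^ m)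
      - K / real (2 * m + 1)\<bar> \<le> K * ((2 * (real m)\<^sup>2 + m + 4) / n)"
proof -
  let ?H = "{..<2 * n}"
  let ?Y = "\<lambda>a s. (real (card (avoiding (orbits_of a ?H) 0 s)) / n) ^ m"
  let ?ind = "\<lambda>a s. indecomposable (orbits_of a ?H) s"
  let ?c = "fact (2 * n) * ((2 * (real m)\<^sup>2 + m + 4) / n)"
  have "\<bar>(\<Sum>s | s permutes ?H \<and> ?ind a s. ?Y a s) - fact (2 * n) / real (2 * m + 1)\<bar> \<le> ?c"
    if a: "a \<in> involutions ?H" for a
  proof -
    interpret pairing ?H "orbits_of a ?H" n
      using a by (intro pairing_orbits_of) auto
    have Y: "0 \<le> ?Y a s" "?Y a s \<le> 1" for s
      using card_avoiding_le[of 0 s] n by (auto intro!: power_le_one simp: divide_le_eq)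
    have fin: "finite {s. s permutes ?H}" by (simp add: finite_permutations)
    have "(\<Sum>s | s permutes ?H. ?Y a s) =
        (\<Sum>s\<in>{s. s permutes ?H \<and> ?ind a s} \<union> {s. s permutes ?H \<and> \<not> ?ind a s}. ?Y a s)"
      by (rule sum.cong) auto
    also have "\<dots> = (\<Sum>s | s permutes ?H \<and> ?ind a s. ?Y a s) + (\<Sum>s | s permutes ?H \<and> \<not> ?ind a s. ?Y a s)"
      using fin by (intro sum.union_disjoint) (auto intro: finite_subset)
    finally have split: "(\<Sum>s | s permutes ?H. ?Y a s) =
        (\<Sum>s | s permutes ?H \<and> ?ind a s. ?Y a s) + (\<Sum>s | s permutes ?H \<and> \<not> ?ind a s. ?Y a s)" .
    have "(\<Sum>s | s permutes ?H \<and> \<not> ?ind a s. ?Y a s) \<le> real (card {s. s permutes ?H \<and> \<not> ?ind a s}) * 1"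
      by (rule sum_bounded_above) (rule Y)
    also have "\<dots> \<le> fact (2 * n) * 4 / n" using card_decomposable_le[OF n] by simp
    finally have "(\<Sum>s | s permutes ?H \<and> \<not> ?ind a s. ?Y a s) \<le> fact (2 * n) * 4 / n" .
    moreover have "0 \<le> (\<Sum>s | s permutes ?H \<and> \<not> ?ind a s. ?Y a s)" by (rule sum_nonneg) (rule Y)
    moreover have "\<bar>(\<Sum>s | s permutes ?H. ?Y a s) - fact (2 * n) / real (2 * m + 1)\<bar>
        \<le> fact (2 * n) * (2 * (real m)\<^sup>2 + m) / n"
      by (rule moment_avoiding) (use n in auto)
    moreover have "?c = fact (2 * n) * (2 * (real m)\<^sup>2 + m) / n + fact (2 * n) * 4 / n"
      by (simp add: algebra_simps add_divide_distrib)
    ultimately show ?thesis using split by linarith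
  qed
  then have "\<bar>\<Sum>a\<in>involutions ?H. (\<Sum>s | s permutes ?H \<and> ?ind a s. ?Y a s) - fact (2 * n) / real (2 * m + 1)\<bar>
      \<le> (\<Sum>a\<in>involutions ?H. ?c)"
    by (intro order.trans[OF sum_abs] sum_mono)
  then show ?thesis
    by (simp add: sum_map_perms sum_subtractf K_def case_prod_unfold mult.assoc)
qed

text \<open>The common fibre size (2n - 1)! cancels between the sum and the number of pairs.\<close>

lemma rooted_maps_moment:
  assumes n: "n > 0" and T: "map_perms {..<2 * n} \<noteq> {}"
  shows "(\<integral>C. (1 - real (root_edge_count C) / n) ^ m \<partial>measure_pmf (pmf_of_set (rooted_maps n)))
    = (\<Sum>(s, a)\<in>map_perms {..<2 * n}. (real (card (avoiding (orbits_of a {..<2 * n}) 0 s)) / n) ^ m)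
      / card (map_perms {..<2 * n})"
proof -
  let ?H = "{..<2 * n}"
  let ?f = "\<lambda>C. (1 - real (root_edge_count C) / n) ^ m"
  have R: "rooted_maps n \<noteq> {}" "finite (rooted_maps n)"
    using T perm_class_surj[OF n] sum_perm_class(3)[OF n] by auto
  have "?f (perm_class n (s, a)) = (real (card (avoiding (orbits_of a ?H) 0 s)) / n) ^ m"
    if "(s, a) \<in> map_perms ?H" for s a
  proof -
    interpret pairing ?H "orbits_of a ?H" n
      using that by (intro pairing_orbits_of) (auto simp: map_perms_def)
    show ?thesis
      using root_edge_count_perm_class[OF n that] card_avoiding_le[of 0 s] n
      by (simp add: of_nat_diff diff_divide_distrib)
  qed
  then have "(\<Sum>(s, a)\<in>map_perms ?H. (real (card (avoiding (orbits_of a ?H) 0 s)) / n) ^ m)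
      = (\<Sum>p\<in>map_perms ?H. ?f (perm_class n p))"
    by (intro sum.cong) auto
  also have "\<dots> = fact (2 * n - 1) * (\<Sum>C\<in>rooted_maps n. ?f C)" by (rule sum_perm_class[OF n])
  finally have 1: "(\<Sum>(s, a)\<in>map_perms ?H. (real (card (avoiding (orbits_of a ?H) 0 s)) / n) ^ m)
      = fact (2 * n - 1) * (\<Sum>C\<in>rooted_maps n. ?f C)" .
  have 2: "real (card (map_perms ?H)) = fact (2 * n - 1) * real (card (rooted_maps n))"
    using sum_perm_class(1)[OF n, of "\<lambda>_. 1"] by simp
  show ?thesis unfolding 1 2 integral_pmf_of_set[OF R] by simp
qed

lemma root_edge_count_le:
  assumes "n > 0" "C \<in> rooted_maps n"
  shows "root_edge_count C \<le> n"
proof -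
  obtain s a where "(s, a) \<in> map_perms {..<2 * n}" "C = perm_class n (s, a)"
    using assms(2) unfolding perm_class_surj[OF assms(1), symmetric] by (metis imageE surj_pair)
  then show ?thesis using root_edge_count_perm_class[OF assms(1)] by simp
qed

lemma map_perms_asymptotics:
  defines "K \<equiv> \<lambda>n. real (card (involutions {..<2 * n})) * fact (2 * n)"
  shows "(\<lambda>n. (\<Sum>(s, a)\<in>map_perms {..<2 * n}.
      (real (card (avoiding (orbits_of a {..<2 * n}) 0 s)) / n) ^ m) / K n) \<longlonglongrightarrow> 1 / real (2 * m + 1)"
    (is "?S \<longlonglongrightarrow> _")
proof -
  have K: "K n > 0" for n
    unfolding K_def using finite_involutions[of "{..<2 * n}"] involutions_nonempty[of n]
    by (simp add: card_gt_0_iff)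
  let ?c = "2 * (real m)\<^sup>2 + m + 4"
  have "\<forall>\<^sub>F n in sequentially. norm (?S n - 1 / real (2 * m + 1)) \<le> ?c / n"
    using eventually_ge_at_top[of 2]
  proof eventually_elim
    case (elim n)
    let ?T = "\<Sum>(s, a)\<in>map_perms {..<2 * n}. (real (card (avoiding (orbits_of a {..<2 * n}) 0 s)) / n) ^ m"
    have "?S n - 1 / real (2 * m + 1) = (?T - K n / real (2 * m + 1)) / K n"
      using K[of n] by (simp add: diff_divide_distrib)
    then have "norm (?S n - 1 / real (2 * m + 1)) = \<bar>?T - K n / real (2 * m + 1)\<bar> / K n"
      using K[of n] by simp
    also have "\<dots> \<le> K n * (?c / n) / K n"
      using map_perms_moment[OF elim, of m] K[of n] unfolding K_def by (intro divide_right_mono) auto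
    also have "\<dots> = ?c / n" using K[of n] by simp
    finally show ?case .
  qed
  then have "(\<lambda>n. ?S n - 1 / real (2 * m + 1)) \<longlonglongrightarrow> 0"
    by (rule Lim_null_comparison) (rule lim_const_over_n)
  then show ?thesis by (rule LIM_zero_cancel)
qed

theorem theorem6:
  "weak_conv_m
     (\<lambda>n. distr (measure_pmf (pmf_of_set (rooted_maps n))) borel
            (\<lambda>C. real (root_edge_count C) / real n))
     (beta_distribution 1 (1/2))"
proof -
  let ?K = "\<lambda>n. real (card (involutions {..<2 * n})) * fact (2 * n)"
  let ?S = "\<lambda>m n. \<Sum>(s, a)\<in>map_perms {..<2 * n}.
      (real (card (avoiding (orbits_of a {..<2 * n}) 0 s)) / n) ^ m"
  let ?M = "\<lambda>n. distr (measure_pmf (pmf_of_set (rooted_maps n))) borel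
            (\<lambda>C. real (root_edge_count C) / real n)"
  have S0: "?S 0 n = real (card (map_perms {..<2 * n}))" for n
    by (simp add: case_prod_unfold)
  \<comment> \<open>The summand for m = 0 is constantly 1, so this is the proportion of transitive
    pairs among all pairs. In particular transitive pairs exist for large n, so that
    \<open>pmf_of_set\<close> is applied to a nonempty set.\<close>
  have card: "(\<lambda>n. real (card (map_perms {..<2 * n})) / ?K n) \<longlonglongrightarrow> 1"
    using map_perms_asymptotics[of 0] unfolding S0 by simp
  have "\<forall>\<^sub>F n in sequentially. real (card (map_perms {..<2 * n})) / ?K n > 0"
    by (rule order_tendstoD(1)[OF card]) simp
  then have T: "\<forall>\<^sub>F n in sequentially. n > 0 \<and> map_perms {..<2 * n} \<noteq> {}"
    using eventually_gt_at_top[of 0] by eventually_elim auto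
  have ratio: "(\<lambda>n. ?S m n / card (map_perms {..<2 * n})) \<longlonglongrightarrow> 1 / real (2 * m + 1)" for m
  proof -
    have "(\<lambda>n. (?S m n / ?K n) / (card (map_perms {..<2 * n}) / ?K n)) \<longlonglongrightarrow> (1 / real (2 * m + 1)) / 1"
      by (intro tendsto_divide map_perms_asymptotics card) simp
    moreover have K: "?K n \<noteq> 0" for n
      using finite_involutions[of "{..<2 * n}"] involutions_nonempty[of n] by simp
    moreover have "(x / k) / (y / k) = x / y" if "k \<noteq> 0" for x y k :: real
      using that by simp
    ultimately show ?thesis by (simp only: div_by_1 K not_False_eq_True)
  qed
  show ?thesis
  \<comment> \<open>With c = 1 the required moments are those of the missed fraction.\<close>
  proof (rule weak_conv_moments_compact[where a = 0 and b = 1 and c = 1])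
    show "real_distribution (?M n)" for n
      by (simp add: real_distribution_def real_distribution_axioms_def measure_pmf.prob_space_distr)
    show "\<forall>\<^sub>F n in sequentially. AE x in ?M n. x \<in> {0..1}"
      using T
    proof eventually_elim
      case (elim n)
      then have n: "n > 0" "rooted_maps n \<noteq> {}" using perm_class_surj[of n] by auto
      have "AE C in measure_pmf (pmf_of_set (rooted_maps n)). real (root_edge_count C) / real n \<in> {0..1}"
        using root_edge_count_le[OF n(1)] sum_perm_class(3)[OF n(1)] n
        by (intro AE_pmfI) (simp add: set_pmf_of_set divide_le_eq)
      then show ?case by (subst AE_distr_iff) simp_all
    qed
    show "real_distribution (beta_distribution 1 (1/2))" by (rule real_distribution_beta)
    show "AE t in beta_distribution 1 (1/2). t \<in> {0..1}" by (rule AE_beta)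
    fix m
    have "\<forall>\<^sub>F n in sequentially. ?S m n / card (map_perms {..<2 * n}) = (\<integral>x. (1 - x) ^ m \<partial>?M n)"
      using T
    proof eventually_elim
      case (elim n)
      then show ?case using rooted_maps_moment[of n m] by (simp add: integral_distr)
    qed
    then show "(\<lambda>n. \<integral>x. (1 - x) ^ m \<partial>?M n) \<longlonglongrightarrow> (\<integral>x. (1 - x) ^ m \<partial>beta_distribution 1 (1/2))"
      unfolding moment_beta by (rule Lim_transform_eventually[OF ratio])
  qed
qed

end
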